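(* Let $(\mu_t)_{t\ge0}\in\mathfrak{P}_b({\bf M}^0(\mathbb R))$, and for $t\ge 0$ let $g_t$ be the solution of the associated chordal Löwner equation, $f_t=g_t^{-1}:\mathbb C^+\to\mathbb C^+\setminus\mathcal K_t$, $G_t=1/f_t$, and $\nu_t$ the unique probability measure on $\mathbb R$ whose Cauchy transform is $G_t$. Then for each $0\le s\le t$ there exists a conformal (injective holomorphic) map $H_{s,t}:\mathbb C^+\to\mathbb C^+$ such that $G_s\circ H_{s,t}=G_t$. The family of maps $\{H_{s,t}\}_{0\le s\le t}$ uniquely defines a Markov transition kernel $\{k_{s,t}(x;du)\}$ on $\mathbb R$ by $$\int_{\mathbb R}\frac{k_{s,t}(x;du)}{z-u}=\frac{1}{H_{s,t}(z)-x},\qquad z\in\mathbb C^+,\ x\in\mathbb R.$$ Moreover, $\nu_t(du)=k_{0,t}(0;du)$ for each $t\ge0$.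
   Context: Notation: $\mathbb C^+=\{z\in\mathbb C:\mathrm{Im}(z)>0\}$. ${\bf M}^0(\mathbb R)$ is the set of nonzero Borel measures on $\mathbb R$ with finite total mass and bounded support, with the topology of weak convergence. $\mathfrak{P}_b({\bf M}^0(\mathbb R))$ is the set of continuous paths $t\in[0,\infty)\mapsto\mu_t\in{\bf M}^0(\mathbb R)$ with $\sup_{t\ge0}\mu_t(\mathbb R)<\infty$. For $z\in\mathbb C^+$ let $g_t(z)$ solve the chordal Löwner equation $$\partial_t g_t(z)=\int_{\mathbb R}\frac{\mu_t(dx)}{g_t(z)-x},\qquad g_0(z)=z,$$ up to its maximal existence time $T_z\in(0,\infty]$, and let $\mathcal K_t$ be the closure of $\{z\in\mathbb C^+:T_z\le t\}$. Then $g_t$ is a conformal map of $\mathbb C^+\setminus\mathcal K_t$ onto $\mathbb C^+$, with inverse $f_t$. The measure $\nu_t$ is the unique probability measure on $\mathbb R$ with $\frac1{f_t(z)}=\int_{\mathbb R}\frac{\nu_t(dx)}{z-x}$ for $z\in\mathbb C^+$. A Markov transition kernel on $\mathbb R$ is a family $\{k_{s,t}(x;du)\}_{0\le s\le t,\,x\in\mathbb R}$ of Borel probability measures on $\mathbb R$, measurable in $x$, with $k_{t,t}(x;\cdot)=\delta_x$ and satisfying the Chapman–Kolmogorov equation $k_{s,t}(x;dv)=\int_{\mathbb R}k_{s,r}(x;du)\,k_{r,t}(u;dv)$ for $0\le s\le r\le t$. *)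

theory Defs
  imports "HOL-Probability.Probability" "HOL-Complex_Analysis.Complex_Analysis"
begin

definition upper_half_plane :: "complex set" where
  "upper_half_plane = {z. Im z > 0}"

definition measure_support :: "real measure \<Rightarrow> real set" where
  "measure_support M = {x. \<forall>U. open U \<and> x \<in> U \<longrightarrow> emeasure M U > 0}"

definition M0 :: "real measure set" where
  "M0 = {M. finite_borel_measure M \<and> emeasure M UNIV \<noteq> 0 \<and> bounded (measure_support M)}"

text \<open>
  The initial topology on \<open>M0\<close> for the maps \<open>M \<mapsto> \<integral> \<phi> dM\<close>, with \<open>\<phi>\<close> bounded and continuous.
  The library's \<^const>\<open>weak_conv_m\<close> is not used: it tests distribution functions at their
  continuity points, which does not control the total mass when it varies.
\<close>
definition weak_topology :: "real measure topology" where
  "weak_topology = topology_generated_by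
     {{M \<in> M0. (\<integral>x. \<phi> x \<partial>M) \<in> U} | (\<phi> :: real \<Rightarrow> real) (U :: real set).
        continuous_on UNIV \<phi> \<and> bounded (range \<phi>) \<and> open U}"

text \<open>Values of a path at negative times are irrelevant.\<close>
definition Pb :: "(real \<Rightarrow> real measure) set" where
  "Pb = {\<mu>. continuous_map (top_of_set {0..}) weak_topology \<mu> \<and>
            bdd_above ((\<lambda>t. measure (\<mu> t) UNIV) ` {0..})}"

definition cauchy_transform :: "real measure \<Rightarrow> complex \<Rightarrow> complex" where
  "cauchy_transform M z = (\<integral>x. 1 / (z - complex_of_real x) \<partial>M)"

text \<open>
  \<open>loewner_solution \<mu> z T \<gamma>\<close>: on \<open>[0, T)\<close> the curve \<open>\<gamma>\<close> stays in the upper half-plane, which is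
  the domain of the vector field, and solves the equation started at \<open>z\<close>.
\<close>
definition loewner_solution ::
    "(real \<Rightarrow> real measure) \<Rightarrow> complex \<Rightarrow> ereal \<Rightarrow> (real \<Rightarrow> complex) \<Rightarrow> bool" where
  "loewner_solution \<mu> z T \<gamma> \<longleftrightarrow>
     \<gamma> 0 = z \<and>
     (\<forall>t\<ge>0. ereal t < T \<longrightarrow>
        \<gamma> t \<in> upper_half_plane \<and>
        (\<gamma> has_vector_derivative cauchy_transform (\<mu> t) (\<gamma> t)) (at t within {0..}))"

definition loewner_lifetime :: "(real \<Rightarrow> real measure) \<Rightarrow> complex \<Rightarrow> ereal" where
  "loewner_lifetime \<mu> z = Sup {T. \<exists>\<gamma>. loewner_solution \<mu> z T \<gamma>}"

text \<open>
  The maximal solution is unique on \<open>[0, T)\<close>, where \<open>T\<close> is the lifetime of \<open>z\<close>; only its values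
  there are meaningful, so the choice operator is harmless.
\<close>
definition loewner_g :: "(real \<Rightarrow> real measure) \<Rightarrow> real \<Rightarrow> complex \<Rightarrow> complex" where
  "loewner_g \<mu> t z = (SOME \<gamma>. loewner_solution \<mu> z (loewner_lifetime \<mu> z) \<gamma>) t"

definition loewner_hull :: "(real \<Rightarrow> real measure) \<Rightarrow> real \<Rightarrow> complex set" where
  "loewner_hull \<mu> t = closure {z \<in> upper_half_plane. loewner_lifetime \<mu> z \<le> ereal t}"

definition loewner_f :: "(real \<Rightarrow> real measure) \<Rightarrow> real \<Rightarrow> complex \<Rightarrow> complex" where
  "loewner_f \<mu> t = the_inv_into (upper_half_plane - loewner_hull \<mu> t) (loewner_g \<mu> t)"

definition loewner_G :: "(real \<Rightarrow> real measure) \<Rightarrow> real \<Rightarrow> complex \<Rightarrow> complex" where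
  "loewner_G \<mu> t z = 1 / loewner_f \<mu> t z"

definition loewner_nu :: "(real \<Rightarrow> real measure) \<Rightarrow> real \<Rightarrow> real measure" where
  "loewner_nu \<mu> t = (THE \<nu>. real_distribution \<nu> \<and>
     (\<forall>z\<in>upper_half_plane. loewner_G \<mu> t z = cauchy_transform \<nu> z))"

definition conformal_self_map :: "(complex \<Rightarrow> complex) \<Rightarrow> bool" where
  "conformal_self_map h \<longleftrightarrow>
     h holomorphic_on upper_half_plane \<and> inj_on h upper_half_plane \<and>
     h ` upper_half_plane \<subseteq> upper_half_plane"

text \<open>
  Membership of \<open>k s t\<close> in the measurable maps into \<^const>\<open>prob_algebra\<close> says that every
  \<open>k s t x\<close> is a Borel probability measure and that \<open>x \<mapsto> k s t x A\<close> is measurable for each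
  Borel set \<open>A\<close>.  The Giry bind is the composition \<open>A \<mapsto> \<integral> k r t u A k s r x (du)\<close>.
\<close>
definition markov_transition_kernel ::
    "(real \<Rightarrow> real \<Rightarrow> real \<Rightarrow> real measure) \<Rightarrow> bool" where
  "markov_transition_kernel k \<longleftrightarrow>
     (\<forall>s t. 0 \<le> s \<and> s \<le> t \<longrightarrow> k s t \<in> borel \<rightarrow>\<^sub>M prob_algebra borel) \<and>
     (\<forall>t\<ge>0. \<forall>x. k t t x = return borel x) \<and>
     (\<forall>s r t x. 0 \<le> s \<and> s \<le> r \<and> r \<le> t \<longrightarrow> k s t x = k s r x \<bind> k r t)"

end

theory Submission
  imports Defs
begin

text \<open>
  Write \<open>V\<^sub>t\<close> for the Cauchy transform of \<open>\<mu>\<^sub>t\<close>, so that the Loewner equation reads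
  \<open>\<gamma>' = V\<^sub>t(\<gamma>)\<close>.  On the upper half-plane \<open>Im V\<^sub>t \<le> 0\<close>: run forwards, a solution sinks and may
  reach the real line, but run backwards it rises, away from the only place where the vector
  field is singular.  Hence the backward flow \<open>\<Phi>\<^sub>s\<^sub>,\<^sub>t\<close>, which sends \<open>w\<close> to the value at time
  \<open>s\<close> of the solution that equals \<open>w\<close> at time \<open>t\<close>, is defined on the whole half-plane.  The
  points whose lifetime exceeds \<open>t\<close> are exactly the image of \<open>\<Phi>\<^sub>0\<^sub>,\<^sub>t\<close>, and there \<open>g\<^sub>t\<close> is
  the inverse of \<open>\<Phi>\<^sub>0\<^sub>,\<^sub>t\<close>; that is, \<open>f\<^sub>t = \<Phi>\<^sub>0\<^sub>,\<^sub>t\<close>.  The flow property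
  \<open>\<Phi>\<^sub>0\<^sub>,\<^sub>s \<circ> \<Phi>\<^sub>s\<^sub>,\<^sub>t = \<Phi>\<^sub>0\<^sub>,\<^sub>t\<close> says that \<open>H\<^sub>s\<^sub>,\<^sub>t = \<Phi>\<^sub>s\<^sub>,\<^sub>t\<close> solves
  \<open>G\<^sub>s \<circ> H\<^sub>s\<^sub>,\<^sub>t = G\<^sub>t\<close>, and injectivity of \<open>\<Phi>\<^sub>0\<^sub>,\<^sub>s\<close> makes it the only solution.

  The regularity of the flow comes from one identity: the difference of two solutions satisfies
  a linear equation, so it is its value at one time multiplied by an exponential
  (\<open>flow_line_diff\<close>).  Uniqueness, injectivity, Lipschitz dependence on \<open>w\<close> and complex
  differentiability in \<open>w\<close> can all be read off from it.

  For the kernels, the backward flow satisfies \<open>Im (\<Phi>\<^sub>s\<^sub>,\<^sub>t z) \<ge> Im z\<close> and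
  \<open>\<Phi>\<^sub>s\<^sub>,\<^sub>t z - z = O(1 / Im z)\<close>.  Therefore \<open>z \<mapsto> 1 / (\<Phi>\<^sub>s\<^sub>,\<^sub>t z - x)\<close> maps the upper
  half-plane to the lower one and behaves like \<open>1 / z\<close> along the imaginary axis, which
  characterizes Cauchy transforms of probability measures
  (\<open>cauchy_transform_representation\<close>, by Poisson's formula on horizontal lines and weak
  compactness).  Stieltjes inversion recovers a measure from its Cauchy transform by limits of
  explicit integrals.  This gives uniqueness (\<open>cauchy_transform_unique\<close>) and measurability in
  \<open>x\<close> (\<open>measurable_kernel_from_cauchy_transform\<close>).  By uniqueness, the Chapman-Kolmogorov equation
  reduces to the flow property: integrating \<open>1 / (\<Phi>\<^sub>r\<^sub>,\<^sub>t z - u)\<close> against \<open>k\<^sub>s\<^sub>,\<^sub>r(x, du)\<close>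
  evaluates the Cauchy transform of \<open>k\<^sub>s\<^sub>,\<^sub>r(x, \<cdot>)\<close> at the point \<open>\<Phi>\<^sub>r\<^sub>,\<^sub>t z\<close>.  In the same way
  \<open>\<nu>\<^sub>t = k\<^sub>0\<^sub>,\<^sub>t(0, \<cdot>)\<close>, because both have Cauchy transform \<open>1 / \<Phi>\<^sub>0\<^sub>,\<^sub>t\<close>.
\<close>

section \<open>Global solutions of ordinary differential equations\<close>

lemma exponential_growth_bound_right:
  fixes h :: "real \<Rightarrow> complex"
  assumes "h 0 = 0" and "\<And>s. (h has_vector_derivative h' s) (at s)"
    and "\<And>s. s \<ge> 0 \<Longrightarrow> norm (h' s) \<le> c * exp (K * s)" and "K > 0" "c \<ge> 0" "s \<ge> 0"
  shows "norm (h s) \<le> c / K * exp (K * s)"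
proof (cases "s = 0")
  case False
  then have "0 < s" using assms by simp
  have "norm (h s - h 0) \<le> c / K * exp (K * s) - c / K * exp (K * 0)"
  proof (rule differentiable_bound_general[OF \<open>0 < s\<close>, where f' = h' and \<phi>' = "\<lambda>s. c * exp (K * s)"])
    show "continuous_on {0..s} h"
      by (intro continuous_at_imp_continuous_on ballI)
        (use assms(2) in \<open>blast intro: has_vector_derivative_continuous\<close>)
    show "continuous_on {0..s} (\<lambda>s. c / K * exp (K * s))" by (intro continuous_intros)
    show "((\<lambda>s. c / K * exp (K * s)) has_vector_derivative c * exp (K * x)) (at x)" for x
      using \<open>K > 0\<close> unfolding has_real_derivative_iff_has_vector_derivative[symmetric]
      by (auto intro!: derivative_eq_intros)
  qed (use assms in auto)
  then show ?thesis using assms by (simp add: divide_nonneg_pos) (smt (verit) divide_nonneg_pos)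
qed (use assms in auto)

text \<open>
  The backward half follows from the forward half by the reflection \<open>s \<mapsto> - s\<close>.  The factor
  \<open>1 / K\<close> is what makes the Picard operator below a contraction.
\<close>
lemma exponential_growth_bound:
  fixes h :: "real \<Rightarrow> complex"
  assumes h0: "h 0 = 0" and h': "\<And>s. (h has_vector_derivative h' s) (at s)"
    and le: "\<And>s. norm (h' s) \<le> c * exp (K * \<bar>s\<bar>)" and "K > 0" "c \<ge> 0"
  shows "norm (h s) \<le> c / K * exp (K * \<bar>s\<bar>)"
proof (cases "s \<ge> 0")
  case True
  then show ?thesis
    using exponential_growth_bound_right[of h h' c K s] assms by (metis abs_of_nonneg)
next
  case False
  have d: "((\<lambda>s. h (- s)) has_vector_derivative - h' (- s)) (at s)" for s
    using vector_diff_chain_at[OF has_vector_derivative_minus[OF has_vector_derivative_id] h'[of "- s"]]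
    by (simp add: o_def)
  have le': "norm (- h' (- s)) \<le> c * exp (K * s)" if "s \<ge> 0" for s
    using le[of "- s"] that by simp
  have "norm (h (- (- s))) \<le> c / K * exp (K * (- s))"
    by (rule exponential_growth_bound_right[where h = "\<lambda>s. h (- s)", OF _ d le'])
      (use assms False in auto)
  then show ?thesis using False by simp
qed

text \<open>
  The Picard operator is a contraction on all of \<open>\<real>\<close> at once if the distance of two curves is
  weighted by \<open>exp (- 2 L \<bar>s\<bar>)\<close>.  To have the unweighted supremum metric available, the curve is
  written as \<open>w + exp (2 L \<bar>s\<bar>) u(s)\<close> with \<open>u\<close> bounded and continuous.
  Continuity in time is required along curves only, the form in which weak continuity of a path of
  measures delivers it.
\<close>
proposition Picard_Lindelof_global_at_0:
  fixes F :: "real \<Rightarrow> complex \<Rightarrow> complex"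
  assumes cont: "\<And>\<phi>. continuous_on UNIV \<phi> \<Longrightarrow> continuous_on UNIV (\<lambda>s. F s (\<phi> s))"
    and lip: "\<And>s z w. norm (F s z - F s w) \<le> L * norm (z - w)" and "L > 0"
    and bdd: "\<And>s z. norm (F s z) \<le> B"
  shows "\<exists>\<phi>. \<phi> 0 = w \<and> (\<forall>s. (\<phi> has_vector_derivative F s (\<phi> s)) (at s))"
proof -
  define K where "K = 2 * L"
  have "K > 0" using \<open>L > 0\<close> by (simp add: K_def)
  have "B \<ge> 0" using bdd[of 0 0] norm_ge_zero order_trans by blast
  define \<psi> where "\<psi> u s = w + exp (K * \<bar>s\<bar>) *\<^sub>R apply_bcontfun u s" for u :: "real \<Rightarrow>\<^sub>C complex" and s
  have cont_\<psi>: "continuous_on UNIV (\<psi> u)" for u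
    unfolding \<psi>_def by (intro continuous_intros) auto
  have "\<exists>g. g 0 = 0 \<and> (\<forall>s. (g has_vector_derivative F s (\<psi> u s)) (at s))" for u
  proof -
    have "isCont (\<lambda>s. F s (\<psi> u s)) s" for s
      using cont[OF cont_\<psi>] by (simp add: continuous_on_eq_continuous_at)
    then obtain g where g: "\<And>s. (g has_vector_derivative F s (\<psi> u s)) (at s)"
      using einterval_antiderivative[of "-\<infinity>" \<infinity> "\<lambda>s. F s (\<psi> u s)"] by auto
    show ?thesis
      by (rule exI[of _ "\<lambda>s. g s - g 0"]) (auto intro!: derivative_eq_intros g)
  qed
  then obtain P where P0: "\<And>u. P u 0 = 0"
    and P': "\<And>u s. (P u has_vector_derivative F s (\<psi> u s)) (at s)" by metis
  have contP: "continuous_on UNIV (P u)" for u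
    by (intro continuous_at_imp_continuous_on ballI)
      (use P' in \<open>blast intro: has_vector_derivative_continuous\<close>)
  have boundP: "norm (P u s) \<le> B / K * exp (K * \<bar>s\<bar>)" for u s
  proof (rule exponential_growth_bound[OF P0 P' _ \<open>K > 0\<close> \<open>B \<ge> 0\<close>])
    fix s
    have "B * 1 \<le> B * exp (K * \<bar>s\<bar>)"
      using \<open>B \<ge> 0\<close> \<open>K > 0\<close> by (intro mult_left_mono) auto
    then show "norm (F s (\<psi> u s)) \<le> B * exp (K * \<bar>s\<bar>)" using bdd[of s "\<psi> u s"] by linarith
  qed
  define T where "T u = Bcontfun (\<lambda>s. exp (- K * \<bar>s\<bar>) *\<^sub>R P u s)" for u
  have T: "apply_bcontfun (T u) s = exp (- K * \<bar>s\<bar>) *\<^sub>R P u s" for u s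
  proof -
    have "norm (exp (- K * \<bar>s\<bar>) *\<^sub>R P u s) \<le> B / K" for s
      using boundP[of u s] by (simp add: exp_minus field_simps)
    then have "bounded (range (\<lambda>s. exp (- K * \<bar>s\<bar>) *\<^sub>R P u s))"
      unfolding bounded_iff by blast
    moreover have "continuous_on UNIV (\<lambda>s. exp (- K * \<bar>s\<bar>) *\<^sub>R P u s)"
      by (intro continuous_intros contP)
    ultimately show ?thesis
      by (simp add: T_def Bcontfun_inverse bcontfun_def)
  qed
  have "dist (T u) (T v) \<le> 1 / 2 * dist u v" for u v
  proof (rule dist_bound)
    fix s
    have "norm (P u s - P v s) \<le> (L * dist u v) / K * exp (K * \<bar>s\<bar>)"
    proof (rule exponential_growth_bound[where h' = "\<lambda>s. F s (\<psi> u s) - F s (\<psi> v s)"])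
      fix s
      have "norm (\<psi> u s - \<psi> v s) = exp (K * \<bar>s\<bar>) * dist (u s) (v s)"
        unfolding \<psi>_def dist_norm by (simp flip: scaleR_diff_right)
      also have "\<dots> \<le> exp (K * \<bar>s\<bar>) * dist u v"
        by (intro mult_left_mono dist_bounded) auto
      finally have "norm (\<psi> u s - \<psi> v s) \<le> exp (K * \<bar>s\<bar>) * dist u v" .
      then have "L * norm (\<psi> u s - \<psi> v s) \<le> L * (exp (K * \<bar>s\<bar>) * dist u v)"
        using \<open>L > 0\<close> by (intro mult_left_mono) auto
      then show "norm (F s (\<psi> u s) - F s (\<psi> v s)) \<le> L * dist u v * exp (K * \<bar>s\<bar>)"
        using lip[of s "\<psi> u s" "\<psi> v s"] by (simp add: ac_simps)
    qed (use \<open>L > 0\<close> \<open>K > 0\<close> in \<open>auto intro!: derivative_eq_intros P' simp: P0\<close>)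
    also have "(L * dist u v) / K = 1 / 2 * dist u v" using \<open>L > 0\<close> by (simp add: K_def)
    finally have "exp (- K * \<bar>s\<bar>) * norm (P u s - P v s) \<le> 1 / 2 * dist u v"
      by (simp add: exp_minus field_simps)
    then show "dist (T u s) (T v s) \<le> 1 / 2 * dist u v"
      by (simp add: T dist_norm flip: scaleR_diff_right)
  qed
  then obtain u where u: "T u = u"
    using banach_fix_type[of "1 / 2" T] by auto
  have "\<psi> u s = w + P u s" for s
  proof -
    have "apply_bcontfun u s = exp (- K * \<bar>s\<bar>) *\<^sub>R P u s" using T[of u s] u by simp
    then show ?thesis by (simp add: \<psi>_def exp_minus)
  qed
  then have \<psi>: "\<psi> u = (\<lambda>s. w + P u s)" by auto
  have "(\<psi> u has_vector_derivative F s (\<psi> u s)) (at s)" for s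
    by (subst \<psi>) (auto intro!: derivative_eq_intros P')
  moreover have "\<psi> u 0 = w" by (simp add: \<psi> P0)
  ultimately show ?thesis by blast
qed

corollary Picard_Lindelof_global:
  fixes F :: "real \<Rightarrow> complex \<Rightarrow> complex"
  assumes cont: "\<And>\<phi>. continuous_on UNIV \<phi> \<Longrightarrow> continuous_on UNIV (\<lambda>s. F s (\<phi> s))"
    and lip: "\<And>s z w. norm (F s z - F s w) \<le> L * norm (z - w)" and "L > 0"
    and bdd: "\<And>s z. norm (F s z) \<le> B"
  obtains \<phi> where "\<phi> t = w" "\<And>s. (\<phi> has_vector_derivative F s (\<phi> s)) (at s)"
proof -
  have "\<exists>\<phi>. \<phi> 0 = w \<and> (\<forall>s. (\<phi> has_vector_derivative F (s + t) (\<phi> s)) (at s))"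
  proof (rule Picard_Lindelof_global_at_0[OF _ lip \<open>L > 0\<close> bdd])
    fix \<phi> :: "real \<Rightarrow> complex" assume "continuous_on UNIV \<phi>"
    then have "continuous_on UNIV (\<lambda>s. \<phi> (s - t))"
      by (rule continuous_on_compose2) (auto intro!: continuous_intros)
    from continuous_on_compose2[OF cont[OF this], of UNIV "\<lambda>s. s + t"]
    show "continuous_on UNIV (\<lambda>s. F (s + t) (\<phi> s))"
      by (simp add: continuous_intros)
  qed
  then obtain \<phi> where \<phi>: "\<phi> 0 = w" "\<And>s. (\<phi> has_vector_derivative F (s + t) (\<phi> s)) (at s)" by blast
  have "((\<lambda>s. \<phi> (s - t)) has_vector_derivative F s (\<phi> (s - t))) (at s)" for s
  proof -
    have "((\<lambda>s. s - t) has_vector_derivative 1) (at s)" by (auto intro!: derivative_eq_intros)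
    from vector_diff_chain_at[OF this \<phi>(2)] show ?thesis by (simp add: o_def)
  qed
  then show ?thesis using that[of "\<lambda>s. \<phi> (s - t)"] \<phi>(1) by simp
qed

section \<open>Cauchy kernels and Cauchy transforms\<close>

lemma mem_upper_half_plane [simp]: "z \<in> upper_half_plane \<longleftrightarrow> Im z > 0"
  by (simp add: upper_half_plane_def)

lemma Im_le_norm_diff_of_real: "Im z \<le> norm (z - complex_of_real x)"
  using abs_Im_le_cmod[of "z - complex_of_real x"] by simp

lemma diff_of_real_nonzero: "Im z > 0 \<Longrightarrow> z - complex_of_real x \<noteq> 0"
  by (auto simp: complex_eq_iff)

lemma norm_Cauchy_kernel_le: "Im z > 0 \<Longrightarrow> norm (1 / (z - complex_of_real x)) \<le> 1 / Im z"
  using Im_le_norm_diff_of_real[of z x] by (simp add: norm_divide frac_le)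

lemma continuous_Cauchy_kernel:
  "Im z > 0 \<Longrightarrow> continuous_on UNIV (\<lambda>x. 1 / (z - complex_of_real x))"
  by (intro continuous_intros) (use diff_of_real_nonzero in blast)

lemma Cauchy_kernel_diff:
  assumes "Im z > 0" "Im w > 0"
  shows "1 / (z - complex_of_real x) - 1 / (w - complex_of_real x)
       = - (z - w) * (1 / (z - complex_of_real x) * (1 / (w - complex_of_real x)))"
  using assms[THEN diff_of_real_nonzero, of x] by (simp add: divide_simps)

lemma norm_Cauchy_kernel_diff_le:
  assumes "Im z > 0" "Im w > 0"
  shows "norm (1 / (z - complex_of_real x) - 1 / (w - complex_of_real x))
       \<le> norm (z - w) / (Im z * Im w)"
proof -
  have "norm (1 / (z - complex_of_real x) - 1 / (w - complex_of_real x))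
      = norm (z - w) * (norm (1 / (z - complex_of_real x)) * norm (1 / (w - complex_of_real x)))"
    unfolding Cauchy_kernel_diff[OF assms] norm_mult norm_minus_cancel by simp
  also have "\<dots> \<le> norm (z - w) * (1 / Im z * (1 / Im w))"
    using assms by (intro mult_left_mono mult_mono norm_Cauchy_kernel_le) auto
  finally show ?thesis by simp
qed

lemma Im_Cauchy_kernel:
  "Im (1 / (z - complex_of_real x)) = - Im z / ((Re z - x)\<^sup>2 + (Im z)\<^sup>2)"
  by (simp add: Im_divide)

lemma continuous_Cauchy_kernel_mult:
  "Im z > 0 \<Longrightarrow> Im w > 0 \<Longrightarrow>
    continuous_on UNIV (\<lambda>x. 1 / (z - complex_of_real x) * (1 / (w - complex_of_real x)))"
  by (intro continuous_on_mult continuous_Cauchy_kernel)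

lemma norm_Cauchy_kernel_mult_le:
  "Im z > 0 \<Longrightarrow> Im w > 0 \<Longrightarrow>
    norm (1 / (z - complex_of_real x) * (1 / (w - complex_of_real x))) \<le> 1 / (Im z * Im w)"
  unfolding norm_mult
  by (rule order_trans[OF mult_mono[OF norm_Cauchy_kernel_le norm_Cauchy_kernel_le]]) auto

text \<open>
  Up to sign the divided difference of the Cauchy transform; on the diagonal it is minus its
  derivative.
\<close>
definition cauchy_quotient :: "real measure \<Rightarrow> complex \<Rightarrow> complex \<Rightarrow> complex" where
  "cauchy_quotient M z w =
     (\<integral>x. 1 / (z - complex_of_real x) * (1 / (w - complex_of_real x)) \<partial>M)"

context finite_borel_measure
begin

lemma integrable_bounded_continuous:
  fixes f :: "real \<Rightarrow> 'b :: {banach, second_countable_topology}"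
  assumes "continuous_on UNIV f" "\<And>x. norm (f x) \<le> B"
  shows "integrable M f"
proof (rule integrable_const_bound[where B = B])
  show "f \<in> borel_measurable M"
    using borel_measurable_continuous_onI[OF assms(1)]
    by (simp cong: measurable_cong_sets add: measurable_cong_sets[OF M_is_borel refl])
qed (use assms in auto)

lemma norm_integral_le:
  fixes f :: "real \<Rightarrow> 'b :: {banach, second_countable_topology}"
  assumes "continuous_on UNIV f" "\<And>x. norm (f x) \<le> B"
  shows "norm (\<integral>x. f x \<partial>M) \<le> B * measure M UNIV"
proof -
  have "norm (\<integral>x. f x \<partial>M) \<le> (\<integral>x. norm (f x) \<partial>M)" by simp
  also have "\<dots> \<le> (\<integral>x. B \<partial>M)"
    by (intro integral_mono integrable_norm integrable_bounded_continuous[OF assms]) (use assms in auto)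
  finally show ?thesis by (simp add: borel_UNIV mult.commute)
qed

lemma integrable_Cauchy_kernel:
  "Im z > 0 \<Longrightarrow> integrable M (\<lambda>x. 1 / (z - complex_of_real x))"
  by (rule integrable_bounded_continuous[OF continuous_Cauchy_kernel norm_Cauchy_kernel_le])

lemma integrable_Cauchy_kernel_mult:
  "Im z > 0 \<Longrightarrow> Im w > 0 \<Longrightarrow>
    integrable M (\<lambda>x. 1 / (z - complex_of_real x) * (1 / (w - complex_of_real x)))"
  by (rule integrable_bounded_continuous[OF continuous_Cauchy_kernel_mult norm_Cauchy_kernel_mult_le])

lemma norm_cauchy_transform_le:
  "Im z > 0 \<Longrightarrow> norm (cauchy_transform M z) \<le> measure M UNIV / Im z"
  using norm_integral_le[OF continuous_Cauchy_kernel norm_Cauchy_kernel_le, of z]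
  by (simp add: cauchy_transform_def)

lemma norm_cauchy_quotient_le:
  "Im z > 0 \<Longrightarrow> Im w > 0 \<Longrightarrow> norm (cauchy_quotient M z w) \<le> measure M UNIV / (Im z * Im w)"
  using norm_integral_le[OF continuous_Cauchy_kernel_mult norm_Cauchy_kernel_mult_le, of z w]
  by (simp add: cauchy_quotient_def)

lemma cauchy_transform_diff:
  assumes "Im z > 0" "Im w > 0"
  shows "cauchy_transform M z - cauchy_transform M w = - (z - w) * cauchy_quotient M z w"
  unfolding cauchy_transform_def cauchy_quotient_def
  by (simp only: integral_mult_right_zero[symmetric] Cauchy_kernel_diff[OF assms]
      Bochner_Integration.integral_diff[OF integrable_Cauchy_kernel[OF assms(1)] integrable_Cauchy_kernel[OF assms(2)], symmetric])

text \<open>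
  Continuity of the divided difference up to the diagonal, which yields the complex derivative of
  the Cauchy transform and, later, that of the flow.
\<close>
lemma norm_cauchy_quotient_diff_le:
  assumes "Im z > 0" "Im z' > 0" "Im w > 0"
  shows "norm (cauchy_quotient M z w - cauchy_quotient M z' w)
       \<le> measure M UNIV * norm (z - z') / (Im z * Im z' * Im w)"
proof -
  have eq: "cauchy_quotient M z w - cauchy_quotient M z' w
      = (\<integral>x. (1 / (z - complex_of_real x) - 1 / (z' - complex_of_real x)) * (1 / (w - complex_of_real x)) \<partial>M)"
    unfolding cauchy_quotient_def left_diff_distrib
    by (intro Bochner_Integration.integral_diff[symmetric] integrable_Cauchy_kernel_mult assms)
  have "norm (cauchy_quotient M z w - cauchy_quotient M z' w)
      \<le> norm (z - z') / (Im z * Im z') * (1 / Im w) * measure M UNIV"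
    unfolding eq
  proof (rule norm_integral_le)
    show "norm ((1 / (z - complex_of_real x) - 1 / (z' - complex_of_real x)) * (1 / (w - complex_of_real x)))
        \<le> norm (z - z') / (Im z * Im z') * (1 / Im w)" for x
      unfolding norm_mult using assms
      by (intro mult_mono norm_Cauchy_kernel_diff_le norm_Cauchy_kernel_le) auto
  qed (intro continuous_on_mult continuous_on_diff continuous_Cauchy_kernel assms)
  then show ?thesis by (simp add: field_simps)
qed

lemma Im_cauchy_transform:
  assumes "Im z > 0"
  shows "Im (cauchy_transform M z) = - (\<integral>x. Im z / ((Re z - x)\<^sup>2 + (Im z)\<^sup>2) \<partial>M)"
  unfolding cauchy_transform_def integral_Im[OF integrable_Cauchy_kernel[OF assms], symmetric]
    Im_Cauchy_kernel by simp

lemma Im_cauchy_transform_nonpos: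
  "Im z > 0 \<Longrightarrow> Im (cauchy_transform M z) \<le> 0"
  by (simp add: Im_cauchy_transform integral_nonneg)

lemma holomorphic_cauchy_transform: "cauchy_transform M holomorphic_on upper_half_plane"
proof -
  have "(cauchy_transform M has_field_derivative - cauchy_quotient M z z) (at z)"
    if z: "Im z > 0" for z
    unfolding has_field_derivative_iff
  proof (rule Lim_transform_eventually)
    have lim: "((\<lambda>w. measure M UNIV * norm (w - z) / (Im w * Im z * Im z)) \<longlongrightarrow> 0) (at z)"
      using z by (auto intro!: tendsto_eq_intros)
    have ev: "eventually (\<lambda>w. Im w > 0) (at z)"
      using z by (intro order_tendstoD(1)[of Im]) (auto intro!: tendsto_intros)
    have "((\<lambda>w. cauchy_quotient M w z - cauchy_quotient M z z) \<longlongrightarrow> 0) (at z)"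
      using ev by (intro Lim_null_comparison[OF _ lim] eventually_mono[OF ev])
        (rule norm_cauchy_quotient_diff_le, use z in auto)
    then show "((\<lambda>w. - cauchy_quotient M w z) \<longlongrightarrow> - cauchy_quotient M z z) (at z)"
      by (intro tendsto_minus) (simp add: LIM_zero_iff)
    have "eventually (\<lambda>w. w \<noteq> z) (at z)" by (simp add: eventually_at_filter)
    with ev show "eventually (\<lambda>w. - cauchy_quotient M w z
        = (cauchy_transform M w - cauchy_transform M z) / (w - z)) (at z)"
      by eventually_elim (use z in \<open>simp add: cauchy_transform_diff divide_simps algebra_simps\<close>)
  qed
  then have "(cauchy_transform M has_field_derivative - cauchy_quotient M z z) (at z within upper_half_plane)"
    if "z \<in> upper_half_plane" for z
    using that by (simp add: has_field_derivative_at_within)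
  then show ?thesis
    unfolding holomorphic_on_def field_differentiable_def by blast
qed

end

section \<open>Driving paths\<close>

locale driving_path =
  fixes \<mu> :: "real \<Rightarrow> real measure"
  assumes path: "\<mu> \<in> Pb"
begin

lemma in_M0: "t \<ge> 0 \<Longrightarrow> \<mu> t \<in> M0"
proof -
  assume "t \<ge> 0"
  have "continuous_map (top_of_set {0..}) weak_topology \<mu>" using path by (simp add: Pb_def)
  then have "\<mu> t \<in> topspace weak_topology"
    using \<open>t \<ge> 0\<close> by (force simp: continuous_map_def)
  then show ?thesis by (auto simp: weak_topology_def)
qed

lemma finite_borel: "t \<ge> 0 \<Longrightarrow> finite_borel_measure (\<mu> t)"
  using in_M0 by (simp add: M0_def)

text \<open>
  The summand \<open>1\<close> makes the bound positive, so that it can serve as a denominator.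
\<close>
definition mass_bound :: real where
  "mass_bound = 1 + (SUP t\<in>{0..}. measure (\<mu> t) UNIV)"

lemma mass_le: "t \<ge> 0 \<Longrightarrow> measure (\<mu> t) UNIV \<le> mass_bound"
  using path cSUP_upper[of t "{0..}" "\<lambda>t. measure (\<mu> t) UNIV"] by (auto simp: Pb_def mass_bound_def)

lemma mass_bound_pos: "mass_bound > 0"
proof -
  have "0 \<le> (SUP t\<in>{0..}. measure (\<mu> t) UNIV)"
    using path cSUP_upper[of 0 "{0..}" "\<lambda>t. measure (\<mu> t) UNIV"]
    by (auto simp: Pb_def intro: order_trans[OF measure_nonneg])
  then show ?thesis by (simp add: mass_bound_def)
qed

lemma continuous_integral_real:
  fixes \<phi> :: "real \<Rightarrow> real"
  assumes "continuous_on UNIV \<phi>" "bounded (range \<phi>)"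
  shows "continuous_on {0..} (\<lambda>t. \<integral>x. \<phi> x \<partial>\<mu> t)"
proof (rule continuous_on_open_gen[where T = UNIV, THEN iffD2])
  show "\<forall>U. openin (top_of_set UNIV) U \<longrightarrow>
    openin (top_of_set {0..}) ({0..} \<inter> (\<lambda>t. \<integral>x. \<phi> x \<partial>\<mu> t) -` U)"
  proof (intro allI impI)
    fix U :: "real set" assume "openin (top_of_set UNIV) U"
    then have "open U" by simp
    let ?V = "{M \<in> M0. (\<integral>x. \<phi> x \<partial>M) \<in> U}"
    have "openin weak_topology ?V"
      unfolding weak_topology_def by (rule topology_generated_by_Basis) (use assms \<open>open U\<close> in blast)
    with path have "openin (top_of_set {0..}) {t \<in> topspace (top_of_set {0..}). \<mu> t \<in> ?V}"
      unfolding Pb_def continuous_map_def by blast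
    moreover have "{t \<in> topspace (top_of_set {0..}). \<mu> t \<in> ?V} = {0..} \<inter> (\<lambda>t. \<integral>x. \<phi> x \<partial>\<mu> t) -` U"
      using in_M0 by auto
    ultimately show "openin (top_of_set {0..}) ({0..} \<inter> (\<lambda>t. \<integral>x. \<phi> x \<partial>\<mu> t) -` U)" by simp
  qed
qed auto

lemma continuous_integral:
  fixes \<phi> :: "real \<Rightarrow> complex"
  assumes "continuous_on UNIV \<phi>" "\<And>x. norm (\<phi> x) \<le> B"
  shows "continuous_on {0..} (\<lambda>t. \<integral>x. \<phi> x \<partial>\<mu> t)"
proof -
  have int: "integrable (\<mu> t) \<phi>" if "t \<ge> 0" for t
    using finite_borel_measure.integrable_bounded_continuous[OF finite_borel[OF that] assms] .
  have "continuous_on {0..} (\<lambda>t. Complex (\<integral>x. Re (\<phi> x) \<partial>\<mu> t) (\<integral>x. Im (\<phi> x) \<partial>\<mu> t))"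
    unfolding Complex_eq
    by (intro continuous_intros continuous_integral_real boundedI[where B = B] assms(1))
      (use assms(2) abs_Re_le_cmod abs_Im_le_cmod order_trans in \<open>fastforce+\<close>)
  then show ?thesis
    by (rule continuous_on_eq) (use int in \<open>simp add: complex_eq_iff\<close>)
qed

text \<open>
  Weak convergence alone handles a fixed integrand.  An integrand that moves uniformly adds an error
  of at most its uniform change times the total mass, and the masses are bounded.
\<close>
lemma continuous_integral_moving:
  fixes \<phi> :: "real \<Rightarrow> real \<Rightarrow> complex"
  assumes S: "S \<subseteq> {0..}"
    and cont: "\<And>s. s \<in> S \<Longrightarrow> continuous_on UNIV (\<phi> s)"
    and bdd: "\<And>s x. s \<in> S \<Longrightarrow> norm (\<phi> s x) \<le> B s"
    and close: "\<And>s r x. s \<in> S \<Longrightarrow> r \<in> S \<Longrightarrow> norm (\<phi> r x - \<phi> s x) \<le> \<omega> s r"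
    and lim: "\<And>s. s \<in> S \<Longrightarrow> (\<omega> s \<longlongrightarrow> 0) (at s within S)"
  shows "continuous_on S (\<lambda>s. \<integral>x. \<phi> s x \<partial>\<mu> s)"
  unfolding continuous_on_def
proof
  fix s assume s: "s \<in> S"
  have "((\<lambda>r. \<integral>x. \<phi> s x \<partial>\<mu> r) \<longlongrightarrow> (\<integral>x. \<phi> s x \<partial>\<mu> s)) (at s within S)"
    using continuous_on_subset[OF continuous_integral[OF cont[OF s] bdd[OF s]] S] s
    by (simp add: continuous_on_def)
  moreover have "((\<lambda>r. (\<integral>x. \<phi> r x \<partial>\<mu> r) - (\<integral>x. \<phi> s x \<partial>\<mu> r)) \<longlongrightarrow> 0) (at s within S)"
  proof (rule Lim_null_comparison)
    show "((\<lambda>r. \<omega> s r * mass_bound) \<longlongrightarrow> 0) (at s within S)"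
      using tendsto_mult_left_zero[OF lim[OF s]] .
    have "norm ((\<integral>x. \<phi> r x \<partial>\<mu> r) - (\<integral>x. \<phi> s x \<partial>\<mu> r)) \<le> \<omega> s r * mass_bound" if r: "r \<in> S" for r
    proof -
      have "r \<ge> 0" using r S by auto
      interpret finite_borel_measure "\<mu> r" using finite_borel[OF \<open>r \<ge> 0\<close>] .
      have "0 \<le> \<omega> s r" using close[OF s r, of 0] norm_ge_zero order_trans by blast
      have "norm (\<integral>x. \<phi> r x - \<phi> s x \<partial>\<mu> r) \<le> \<omega> s r * measure (\<mu> r) UNIV"
        by (intro norm_integral_le continuous_on_diff cont close s r)
      also have "\<dots> \<le> \<omega> s r * mass_bound"
        by (intro mult_left_mono mass_le \<open>0 \<le> r\<close> \<open>0 \<le> \<omega> s r\<close>)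
      finally show ?thesis
        by (subst Bochner_Integration.integral_diff[symmetric])
          (use integrable_bounded_continuous[OF cont bdd] r s in auto)
    qed
    then show "\<forall>\<^sub>F r in at s within S. norm ((\<integral>x. \<phi> r x \<partial>\<mu> r) - (\<integral>x. \<phi> s x \<partial>\<mu> r)) \<le> \<omega> s r * mass_bound"
      by (simp add: eventually_at_filter)
  qed
  ultimately show "((\<lambda>s. \<integral>x. \<phi> s x \<partial>\<mu> s) \<longlongrightarrow> (\<integral>x. \<phi> s x \<partial>\<mu> s)) (at s within S)"
    using tendsto_add by fastforce
qed

lemma continuous_on_cauchy_transform:
  assumes "S \<subseteq> {0..}" "continuous_on S \<gamma>" "\<And>s. s \<in> S \<Longrightarrow> Im (\<gamma> s) > 0"
  shows "continuous_on S (\<lambda>s. cauchy_transform (\<mu> s) (\<gamma> s))"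
  unfolding cauchy_transform_def
proof (rule continuous_integral_moving[OF assms(1)])
  fix s assume s: "s \<in> S"
  then have "(\<gamma> \<longlongrightarrow> \<gamma> s) (at s within S)" using assms(2) by (simp add: continuous_on_def)
  then show "((\<lambda>r. norm (\<gamma> r - \<gamma> s) / (Im (\<gamma> r) * Im (\<gamma> s))) \<longlongrightarrow> 0) (at s within S)"
    using assms(3)[OF s] by (auto intro!: tendsto_eq_intros)
qed (use assms in \<open>auto intro!: continuous_Cauchy_kernel norm_Cauchy_kernel_le norm_Cauchy_kernel_diff_le\<close>)

lemma continuous_on_cauchy_quotient:
  assumes "S \<subseteq> {0..}" "continuous_on S \<gamma>" "\<And>s. s \<in> S \<Longrightarrow> Im (\<gamma> s) > 0"
    "continuous_on S \<delta>" "\<And>s. s \<in> S \<Longrightarrow> Im (\<delta> s) > 0"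
  shows "continuous_on S (\<lambda>s. cauchy_quotient (\<mu> s) (\<gamma> s) (\<delta> s))"
  unfolding cauchy_quotient_def
proof (rule continuous_integral_moving[OF assms(1)])
  fix s r x assume s: "s \<in> S" and r: "r \<in> S"
  let ?k = "\<lambda>z. 1 / (z - complex_of_real x)"
  have "norm (?k (\<gamma> r) * ?k (\<delta> r) - ?k (\<gamma> s) * ?k (\<delta> s))
      = norm ((?k (\<gamma> r) - ?k (\<gamma> s)) * ?k (\<delta> r) + ?k (\<gamma> s) * (?k (\<delta> r) - ?k (\<delta> s)))"
    by (simp only: algebra_simps) simp
  also have "\<dots> \<le> norm (?k (\<gamma> r) - ?k (\<gamma> s)) * norm (?k (\<delta> r)) + norm (?k (\<gamma> s)) * norm (?k (\<delta> r) - ?k (\<delta> s))"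
    by (rule order_trans[OF norm_triangle_ineq]) (simp only: norm_mult)
  also have "\<dots> \<le> norm (\<gamma> r - \<gamma> s) / (Im (\<gamma> r) * Im (\<gamma> s)) * (1 / Im (\<delta> r))
      + 1 / Im (\<gamma> s) * (norm (\<delta> r - \<delta> s) / (Im (\<delta> r) * Im (\<delta> s)))"
    using assms(3,5)[OF s] assms(3,5)[OF r]
    by (intro add_mono mult_mono norm_Cauchy_kernel_diff_le norm_Cauchy_kernel_le) auto
  finally show "norm (?k (\<gamma> r) * ?k (\<delta> r) - ?k (\<gamma> s) * ?k (\<delta> s))
    \<le> norm (\<gamma> r - \<gamma> s) / (Im (\<gamma> r) * Im (\<gamma> s)) * (1 / Im (\<delta> r))
      + 1 / Im (\<gamma> s) * (norm (\<delta> r - \<delta> s) / (Im (\<delta> r) * Im (\<delta> s)))" .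
next
  fix s assume s: "s \<in> S"
  then have "(\<gamma> \<longlongrightarrow> \<gamma> s) (at s within S)" "(\<delta> \<longlongrightarrow> \<delta> s) (at s within S)"
    using assms(2,4) by (simp_all add: continuous_on_def)
  then show "((\<lambda>r. norm (\<gamma> r - \<gamma> s) / (Im (\<gamma> r) * Im (\<gamma> s)) * (1 / Im (\<delta> r))
      + 1 / Im (\<gamma> s) * (norm (\<delta> r - \<delta> s) / (Im (\<delta> r) * Im (\<delta> s)))) \<longlongrightarrow> 0) (at s within S)"
    using assms(3,5)[OF s] by (auto intro!: tendsto_eq_intros)
next
  fix s assume s: "s \<in> S"
  show "continuous_on UNIV (\<lambda>x. 1 / (\<gamma> s - complex_of_real x) * (1 / (\<delta> s - complex_of_real x)))"
    by (intro continuous_on_mult continuous_Cauchy_kernel assms s)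
  show "norm (1 / (\<gamma> s - complex_of_real x) * (1 / (\<delta> s - complex_of_real x))) \<le> 1 / Im (\<gamma> s) * (1 / Im (\<delta> s))" for x
    unfolding norm_mult using assms(3,5)[OF s] by (intro mult_mono norm_Cauchy_kernel_le) auto
qed

end

section \<open>The backward flow\<close>

lemma norm_increment_le:
  fixes f :: "real \<Rightarrow> complex"
  assumes "a \<le> b" and f': "\<And>s. s \<in> {a..b} \<Longrightarrow> (f has_vector_derivative f' s) (at s within {a..b})"
    and "\<And>s. s \<in> {a..b} \<Longrightarrow> norm (f' s) \<le> B"
  shows "norm (f b - f a) \<le> B * (b - a)"
proof (cases "a < b")
  case True
  have "norm (f b - f a) \<le> B * b - B * a"
  proof (rule differentiable_bound_general[OF True])
    show "continuous_on {a..b} f"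
      using f' by (meson continuous_on_eq_continuous_within has_vector_derivative_continuous)
    show "(f has_vector_derivative f' x) (at x)" if "a < x" "x < b" for x
      using f'[of x] that by (simp add: at_within_Icc_at)
    show "((\<lambda>s. B * s) has_vector_derivative B) (at x)" for x
      by (auto intro!: derivative_eq_intros)
  qed (use assms in \<open>auto intro!: continuous_intros\<close>)
  then show ?thesis by (simp add: algebra_simps)
qed (use assms in auto)

text \<open>
  The nearest point projection onto \<open>{z. \<epsilon> \<le> Im z}\<close>.  Composed with it, the Loewner vector field
  becomes bounded and globally Lipschitz.
\<close>
definition raise_Im :: "real \<Rightarrow> complex \<Rightarrow> complex" where
  "raise_Im \<epsilon> z = Complex (Re z) (max \<epsilon> (Im z))"

lemma Im_raise_Im: "\<epsilon> \<le> Im (raise_Im \<epsilon> z)"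
  by (simp add: raise_Im_def)

lemma raise_Im_id: "\<epsilon> \<le> Im z \<Longrightarrow> raise_Im \<epsilon> z = z"
  by (simp add: raise_Im_def complex_eq_iff)

lemma norm_raise_Im_diff_le: "norm (raise_Im \<epsilon> z - raise_Im \<epsilon> w) \<le> norm (z - w)"
proof -
  have "\<bar>max \<epsilon> (Im z) - max \<epsilon> (Im w)\<bar> \<le> \<bar>Im z - Im w\<bar>" by linarith
  then have "(max \<epsilon> (Im z) - max \<epsilon> (Im w))\<^sup>2 \<le> (Im z - Im w)\<^sup>2"
    using abs_le_square_iff by blast
  then show ?thesis
    by (auto simp: raise_Im_def cmod_def intro!: real_sqrt_le_mono)
qed

lemma continuous_raise_Im: "continuous_on S (raise_Im \<epsilon>)"
  unfolding raise_Im_def Complex_eq by (intro continuous_intros)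

context driving_path
begin

text \<open>
  The derivative is taken within \<open>{0..}\<close>, as in the definition of a Loewner solution, even when \<open>I\<close> is a
  smaller interval.
\<close>
definition flow_line :: "(real \<Rightarrow> complex) \<Rightarrow> real set \<Rightarrow> bool" where
  "flow_line \<gamma> I \<longleftrightarrow> (\<forall>s\<in>I. \<gamma> s \<in> upper_half_plane \<and>
     (\<gamma> has_vector_derivative cauchy_transform (\<mu> s) (\<gamma> s)) (at s within {0..}))"

lemma flow_line_subset: "flow_line \<gamma> I \<Longrightarrow> J \<subseteq> I \<Longrightarrow> flow_line \<gamma> J"
  by (auto simp: flow_line_def)

lemma flow_line_continuous: "flow_line \<gamma> {a..b} \<Longrightarrow> 0 \<le> a \<Longrightarrow> continuous_on {a..b} \<gamma>"
  unfolding flow_line_def continuous_on_eq_continuous_within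
  by (meson atLeastAtMost_iff atLeast_iff continuous_within_subset has_vector_derivative_continuous
      order_trans subsetI)

text \<open>
  The vector field is cut off below height \<open>Im w / 2\<close>, which makes global solutions available.  The
  imaginary part of a solution is nonincreasing, so before time \<open>t\<close> the cut-off is not felt; after time
  \<open>t\<close> the bounded speed leaves a time \<open>\<eta>\<close> before the solution can have sunk that far.  The
  extension past \<open>t\<close> is what shows that the lifetime of the starting point is strictly larger
  than \<open>t\<close>.
\<close>
lemma flow_line_exists:
  assumes "t \<ge> 0" "Im w > 0"
  obtains \<gamma> \<eta> where "\<eta> > 0" "\<gamma> t = w" "flow_line \<gamma> {0..t + \<eta>}" "\<And>s. s \<le> t \<Longrightarrow> Im w \<le> Im (\<gamma> s)"
proof -
  define \<epsilon> where "\<epsilon> = Im w / 2"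
  have "\<epsilon> > 0" using assms by (simp add: \<epsilon>_def)
  define F where "F s z = cauchy_transform (\<mu> (max s 0)) (raise_Im \<epsilon> z)" for s z
  define B where "B = mass_bound / \<epsilon>"
  have "B > 0" using \<open>\<epsilon> > 0\<close> mass_bound_pos by (simp add: B_def)
  have Im_pos: "Im (raise_Im \<epsilon> z) > 0" for z
    using \<open>\<epsilon> > 0\<close> Im_raise_Im[of \<epsilon> z] by linarith
  have fin: "finite_borel_measure (\<mu> (max s 0))" for s by (simp add: finite_borel)
  have mass: "measure (\<mu> (max s 0)) UNIV \<le> mass_bound" for s by (simp add: mass_le)
  have F_bound: "norm (F s z) \<le> B" for s z
  proof -
    have "norm (F s z) \<le> measure (\<mu> (max s 0)) UNIV / Im (raise_Im \<epsilon> z)"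
      unfolding F_def by (rule finite_borel_measure.norm_cauchy_transform_le[OF fin Im_pos])
    also have "\<dots> \<le> B"
      unfolding B_def using mass \<open>\<epsilon> > 0\<close> mass_bound_pos Im_raise_Im by (intro frac_le) auto
    finally show ?thesis .
  qed
  have F_lip: "norm (F s z - F s z') \<le> mass_bound / (\<epsilon> * \<epsilon>) * norm (z - z')" for s z z'
  proof -
    have "norm (F s z - F s z') = norm (raise_Im \<epsilon> z - raise_Im \<epsilon> z')
        * norm (cauchy_quotient (\<mu> (max s 0)) (raise_Im \<epsilon> z) (raise_Im \<epsilon> z'))"
      unfolding F_def finite_borel_measure.cauchy_transform_diff[OF fin Im_pos Im_pos]
      by (simp add: norm_mult norm_minus_commute)
    also have "\<dots> \<le> norm (z - z') * (mass_bound / (\<epsilon> * \<epsilon>))"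
    proof (intro mult_mono norm_raise_Im_diff_le)
      have "norm (cauchy_quotient (\<mu> (max s 0)) (raise_Im \<epsilon> z) (raise_Im \<epsilon> z'))
          \<le> measure (\<mu> (max s 0)) UNIV / (Im (raise_Im \<epsilon> z) * Im (raise_Im \<epsilon> z'))"
        by (rule finite_borel_measure.norm_cauchy_quotient_le[OF fin Im_pos Im_pos])
      also have "\<dots> \<le> mass_bound / (\<epsilon> * \<epsilon>)"
        using mass \<open>\<epsilon> > 0\<close> mass_bound_pos Im_raise_Im less_imp_le[OF Im_pos] by (intro frac_le mult_mono) auto
      finally show "norm (cauchy_quotient (\<mu> (max s 0)) (raise_Im \<epsilon> z) (raise_Im \<epsilon> z'))
          \<le> mass_bound / (\<epsilon> * \<epsilon>)" .
    qed auto
    finally show ?thesis by (simp add: mult.commute)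
  qed
  have F_cont: "continuous_on UNIV (\<lambda>s. F s (\<phi> s))" if \<phi>: "continuous_on UNIV \<phi>" for \<phi>
  proof -
    have 0: "continuous_on {0..} (\<lambda>s. F s (\<phi> (s + c)))" for c
    proof (rule continuous_on_eq)
      have "continuous_on {0..} (\<lambda>s. \<phi> (s + c))"
        by (rule continuous_on_compose2[OF \<phi>]) (auto intro!: continuous_intros)
      then show "continuous_on {0..} (\<lambda>s. cauchy_transform (\<mu> s) (raise_Im \<epsilon> (\<phi> (s + c))))"
        by (intro continuous_on_cauchy_transform Im_pos
            continuous_on_compose2[OF continuous_raise_Im[of UNIV]]) auto
    qed (simp add: F_def)
    have pos: "continuous_on {0..} (\<lambda>s. F s (\<phi> s))" using 0[of 0] by simp
    \<comment> \<open>for negative times the measure is \<open>\<mu> 0\<close>, so only the space variable moves\<close>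
    have neg: "continuous_on {..0} (\<lambda>s. F s (\<phi> s))"
    proof (rule continuous_on_eq)
      have "continuous_on UNIV (F 0)"
      proof (rule continuous_at_imp_continuous_on, rule ballI)
        fix z
        show "isCont (F 0) z"
        proof (rule isCont_def[THEN iffD2], rule LIM_zero_cancel, rule Lim_null_comparison)
          show "\<forall>\<^sub>F z' in at z. norm (F 0 z' - F 0 z) \<le> mass_bound / (\<epsilon> * \<epsilon>) * norm (z' - z)"
            by (intro always_eventually allI F_lip)
          show "((\<lambda>z'. mass_bound / (\<epsilon> * \<epsilon>) * norm (z' - z)) \<longlongrightarrow> 0) (at z)"
            using \<open>\<epsilon> > 0\<close> by (auto intro!: tendsto_eq_intros)
        qed
      qed
      then show "continuous_on {..0} (\<lambda>s. F 0 (\<phi> s))"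
        by (rule continuous_on_compose2) (use continuous_on_subset[OF \<phi>] in auto)
    qed (simp add: F_def max_def)
    have "{..0} \<union> {0..} = (UNIV :: real set)" by auto
    with continuous_on_closed_Un[OF _ _ neg pos] show ?thesis by auto
  qed
  obtain \<phi> where \<phi>t: "\<phi> t = w" and \<phi>': "\<And>s. (\<phi> has_vector_derivative F s (\<phi> s)) (at s)"
    using Picard_Lindelof_global[OF F_cont F_lip _ F_bound] \<open>\<epsilon> > 0\<close> mass_bound_pos by auto
  have Im': "((\<lambda>s. Im (\<phi> s)) has_real_derivative Im (F s (\<phi> s))) (at s)" for s
    using bounded_linear.has_vector_derivative[OF bounded_linear_Im \<phi>'[of s]]
    by (simp add: has_real_derivative_iff_has_vector_derivative)
  have F_Im: "Im (F s z) \<le> 0" for s z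
    unfolding F_def by (rule finite_borel_measure.Im_cauchy_transform_nonpos[OF fin Im_pos])
  have behind: "Im w \<le> Im (\<phi> s)" if "s \<le> t" for s
    using DERIV_nonpos_imp_nonincreasing[OF that, of "\<lambda>s. Im (\<phi> s)"] Im' F_Im \<phi>t by auto
  have ahead: "Im w - B * (s - t) \<le> Im (\<phi> s)" if "t \<le> s" for s
  proof -
    have "((\<lambda>s. Im (\<phi> s) + B * s) has_real_derivative Im (F s (\<phi> s)) + B) (at s)" for s
      using DERIV_add[OF Im'[of s] DERIV_cmult_Id[of B]] .
    moreover have "Im (F s (\<phi> s)) + B \<ge> 0" for s
      using F_bound[of s "\<phi> s"] abs_Im_le_cmod[of "F s (\<phi> s)"] by linarith
    ultimately have "Im (\<phi> t) + B * t \<le> Im (\<phi> s) + B * s"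
      using DERIV_nonneg_imp_nondecreasing[OF that, of "\<lambda>s. Im (\<phi> s) + B * s"] by blast
    then show ?thesis by (simp add: \<phi>t algebra_simps)
  qed
  define \<eta> where "\<eta> = \<epsilon> / B"
  have "\<eta> > 0" using \<open>\<epsilon> > 0\<close> \<open>B > 0\<close> by (simp add: \<eta>_def)
  have high: "\<epsilon> \<le> Im (\<phi> s)" if "s \<le> t + \<eta>" for s
  proof (cases "s \<le> t")
    case True
    then show ?thesis using behind[of s] assms by (simp add: \<epsilon>_def)
  next
    case False
    have "B * (s - t) \<le> B * \<eta>" using that \<open>B > 0\<close> by (intro mult_left_mono) auto
    also have "B * \<eta> = \<epsilon>" using \<open>B > 0\<close> by (simp add: \<eta>_def)
    finally show ?thesis using ahead[of s] False by (simp add: \<epsilon>_def)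
  qed
  have "flow_line \<phi> {0..t + \<eta>}"
    unfolding flow_line_def
  proof
    fix s assume s: "s \<in> {0..t + \<eta>}"
    then have "F s (\<phi> s) = cauchy_transform (\<mu> s) (\<phi> s)"
      using high[of s] by (simp add: F_def raise_Im_id)
    then show "\<phi> s \<in> upper_half_plane \<and>
        (\<phi> has_vector_derivative cauchy_transform (\<mu> s) (\<phi> s)) (at s within {0..})"
      using high[of s] \<open>\<epsilon> > 0\<close> \<phi>'[of s] s by (auto intro: has_vector_derivative_at_within)
  qed
  then show ?thesis
    using that[of \<eta> \<phi>] \<open>\<eta> > 0\<close> \<phi>t behind by blast
qed

text \<open>
  The Cauchy kernel satisfies \<open>1/(z - x) - 1/(w - x) = - (z - w) / ((z - x) (w - x))\<close>.  Therefore the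
  difference of two solutions solves a linear homogeneous equation, and the exponential of a primitive of the
  coefficient is an integrating factor.
\<close>
lemma flow_line_diff:
  assumes "0 \<le> a" "a \<le> b" "flow_line \<gamma> {a..b}" "flow_line \<delta> {a..b}"
  obtains B where "B b = 0"
    "\<And>s. s \<in> {a..b} \<Longrightarrow>
       (B has_vector_derivative - cauchy_quotient (\<mu> s) (\<gamma> s) (\<delta> s)) (at s within {a..b})"
    "\<And>s. s \<in> {a..b} \<Longrightarrow> \<gamma> s - \<delta> s = (\<gamma> b - \<delta> b) * exp (B s)"
proof -
  define Q where "Q s = - cauchy_quotient (\<mu> s) (\<gamma> s) (\<delta> s)" for s
  have pos: "Im (\<gamma> s) > 0" "Im (\<delta> s) > 0" if "s \<in> {a..b}" for s
    using assms(3,4) that by (auto simp: flow_line_def)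
  have sub: "{a..b} \<subseteq> {0..}" using assms by auto
  have "continuous_on {a..b} Q"
    unfolding Q_def
    by (intro continuous_on_minus continuous_on_cauchy_quotient flow_line_continuous pos sub assms)
  then obtain g where g: "\<And>s. s \<in> {a..b} \<Longrightarrow> (g has_vector_derivative Q s) (at s within {a..b})"
    using antiderivative_continuous by blast
  define B where "B s = g s - g b" for s
  have B': "(B has_vector_derivative Q s) (at s within {a..b})" if "s \<in> {a..b}" for s
    unfolding B_def by (auto intro!: derivative_eq_intros g that)
  have zero: "((\<lambda>s. (\<gamma> s - \<delta> s) * exp (- B s)) has_vector_derivative 0) (at s within {a..b})"
    if s: "s \<in> {a..b}" for s
  proof -
    have "((\<lambda>s. - B s) has_vector_derivative - Q s) (at s within {a..b})"
      by (auto intro!: derivative_eq_intros B' s)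
    then have E: "((\<lambda>s. exp (- B s)) has_vector_derivative - Q s * exp (- B s)) (at s within {a..b})"
      using field_vector_diff_chain_within[OF _ DERIV_subset[OF DERIV_exp], of "\<lambda>s. - B s" "- Q s" s "{a..b}"]
      by (simp add: o_def)
    have "(\<gamma> has_vector_derivative cauchy_transform (\<mu> s) (\<gamma> s)) (at s within {a..b})"
      "(\<delta> has_vector_derivative cauchy_transform (\<mu> s) (\<delta> s)) (at s within {a..b})"
      using assms(3,4) s by (auto simp: flow_line_def intro!: has_vector_derivative_within_subset[OF _ sub])
    then have D: "((\<lambda>s. \<gamma> s - \<delta> s) has_vector_derivative
        cauchy_transform (\<mu> s) (\<gamma> s) - cauchy_transform (\<mu> s) (\<delta> s)) (at s within {a..b})"
      by (rule has_vector_derivative_diff)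
    have "finite_borel_measure (\<mu> s)" using finite_borel s sub by auto
    then have "cauchy_transform (\<mu> s) (\<gamma> s) - cauchy_transform (\<mu> s) (\<delta> s) = (\<gamma> s - \<delta> s) * Q s"
      using finite_borel_measure.cauchy_transform_diff[OF _ pos[OF s]] by (simp add: Q_def algebra_simps)
    with has_vector_derivative_mult[OF D E] show ?thesis by (simp add: algebra_simps)
  qed
  then obtain c where c: "\<And>s. s \<in> {a..b} \<Longrightarrow> (\<gamma> s - \<delta> s) * exp (- B s) = c"
    using has_vector_derivative_zero_constant[OF convex_real_interval(5) zero] by blast
  show ?thesis
  proof (rule that)
    show "B b = 0" by (simp add: B_def)
    show "(B has_vector_derivative - cauchy_quotient (\<mu> s) (\<gamma> s) (\<delta> s)) (at s within {a..b})"
      if "s \<in> {a..b}" for s using B'[OF that] by (simp add: Q_def)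
    show "\<gamma> s - \<delta> s = (\<gamma> b - \<delta> b) * exp (B s)" if "s \<in> {a..b}" for s
    proof -
      have "\<gamma> s - \<delta> s = (\<gamma> s - \<delta> s) * exp (- B s) * exp (B s)"
        by (simp add: exp_minus)
      also have "(\<gamma> s - \<delta> s) * exp (- B s) = \<gamma> b - \<delta> b"
        using c[OF that] c[of b] assms(2) by (simp add: B_def)
      finally show ?thesis .
    qed
  qed
qed

lemma flow_line_unique_backward:
  assumes "0 \<le> a" "flow_line \<gamma> {a..b}" "flow_line \<delta> {a..b}" "\<gamma> b = \<delta> b" "s \<in> {a..b}"
  shows "\<gamma> s = \<delta> s"
  using flow_line_diff[OF assms(1) _ assms(2,3)] assms(4,5) by (metis atLeastAtMost_iff order_trans
      diff_self eq_iff_diff_eq_0 mult_zero_left)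

lemma flow_line_unique_forward:
  assumes "0 \<le> a" "flow_line \<gamma> {a..b}" "flow_line \<delta> {a..b}" "\<gamma> a = \<delta> a" "s \<in> {a..b}"
  shows "\<gamma> s = \<delta> s"
proof -
  have "a \<le> b" using assms by simp
  then have "\<gamma> b = \<delta> b"
    using flow_line_diff[OF assms(1) _ assms(2,3)] assms(4)
    by (metis atLeastAtMost_iff order_refl exp_not_eq_zero right_minus_eq mult_eq_0_iff)
  then show ?thesis using flow_line_unique_backward assms by blast
qed

text \<open>
  The solution is unique on \<open>[0, t]\<close>, so the choice operator does not affect the values at these
  times.  The condition at times \<open>s < 0\<close> only spares a case distinction in statements about \<open>s \<le> t\<close>.
\<close>
definition back_flow :: "real \<Rightarrow> real \<Rightarrow> complex \<Rightarrow> complex" where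
  "back_flow s t w = (SOME \<gamma>. \<gamma> t = w \<and> flow_line \<gamma> {0..t} \<and> (\<forall>s\<le>t. Im w \<le> Im (\<gamma> s))) s"

lemma back_flow:
  assumes "0 \<le> t" "Im w > 0"
  shows back_flow_end: "back_flow t t w = w"
    and flow_line_back_flow: "flow_line (\<lambda>s. back_flow s t w) {0..t}"
    and Im_back_flow: "s \<le> t \<Longrightarrow> Im w \<le> Im (back_flow s t w)"
proof -
  have "\<exists>\<gamma>. \<gamma> t = w \<and> flow_line \<gamma> {0..t} \<and> (\<forall>s\<le>t. Im w \<le> Im (\<gamma> s))"
  proof -
    obtain \<gamma> \<eta> where "\<eta> > 0" "\<gamma> t = w" "flow_line \<gamma> {0..t + \<eta>}" "\<And>s. s \<le> t \<Longrightarrow> Im w \<le> Im (\<gamma> s)"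
      using flow_line_exists[OF assms] by blast
    then show ?thesis by (intro exI[of _ \<gamma>]) (auto intro: flow_line_subset)
  qed
  from someI_ex[OF this] show "back_flow t t w = w" "flow_line (\<lambda>s. back_flow s t w) {0..t}"
    "s \<le> t \<Longrightarrow> Im w \<le> Im (back_flow s t w)"
    unfolding back_flow_def by blast+
qed

lemma back_flow_pos: "0 \<le> t \<Longrightarrow> Im w > 0 \<Longrightarrow> s \<le> t \<Longrightarrow> Im (back_flow s t w) > 0"
  using Im_back_flow by force

lemma back_flow_eqI:
  assumes "0 \<le> s" "s \<le> t" "flow_line \<gamma> {s..t}"
  shows "back_flow s t (\<gamma> t) = \<gamma> s"
proof (rule flow_line_unique_backward[OF assms(1)])
  have pos: "0 \<le> t" "Im (\<gamma> t) > 0" using assms by (auto simp: flow_line_def)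
  show "flow_line (\<lambda>s. back_flow s t (\<gamma> t)) {s..t}"
    using flow_line_back_flow[OF pos] by (rule flow_line_subset) (use assms in auto)
  show "back_flow t t (\<gamma> t) = \<gamma> t" using back_flow_end[OF pos] .
qed (use assms in auto)

lemma back_flow_back_flow:
  assumes "0 \<le> s" "s \<le> r" "r \<le> t" "Im w > 0"
  shows "back_flow s r (back_flow r t w) = back_flow s t w"
proof (rule back_flow_eqI)
  show "flow_line (\<lambda>s. back_flow s t w) {s..r}"
    using flow_line_back_flow[of t w] by (rule flow_line_subset) (use assms in auto)
qed (use assms in auto)

lemma back_flow_diff:
  assumes "0 \<le> s" "s \<le> t" "Im z > 0" "Im w > 0"
  obtains B where "B t = 0"
    "\<And>r. r \<in> {s..t} \<Longrightarrow> (B has_vector_derivative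
       - cauchy_quotient (\<mu> r) (back_flow r t z) (back_flow r t w)) (at r within {s..t})"
    "\<And>r. r \<in> {s..t} \<Longrightarrow> back_flow r t z - back_flow r t w = (z - w) * exp (B r)"
proof -
  have "flow_line (\<lambda>s. back_flow s t u) {s..t}" if "Im u > 0" for u
    using flow_line_back_flow[of t u] by (rule flow_line_subset) (use assms that in auto)
  note lines = this[OF assms(3)] this[OF assms(4)]
  have "back_flow t t z = z" "back_flow t t w = w" using assms back_flow_end by auto
  then show ?thesis
    using flow_line_diff[OF assms(1,2) lines] that by auto
qed

lemma back_flow_inj:
  assumes "0 \<le> s" "s \<le> t" "Im z > 0" "Im w > 0" "back_flow s t z = back_flow s t w"
  shows "z = w"
proof (rule back_flow_diff[OF assms(1-4)])
  fix B assume "\<And>r. r \<in> {s..t} \<Longrightarrow> back_flow r t z - back_flow r t w = (z - w) * exp (B r)"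
  from this[of s] show "z = w" using assms by simp
qed

lemma norm_cauchy_quotient_back_flow_le:
  assumes "0 \<le> r" "r \<le> t" "Im z > 0" "Im w > 0"
  shows "norm (cauchy_quotient (\<mu> r) (back_flow r t z) (back_flow r t w)) \<le> mass_bound / (Im z * Im w)"
proof -
  have pos: "Im (back_flow r t z) > 0" "Im (back_flow r t w) > 0"
    using assms back_flow_pos by auto
  have "norm (cauchy_quotient (\<mu> r) (back_flow r t z) (back_flow r t w))
      \<le> measure (\<mu> r) UNIV / (Im (back_flow r t z) * Im (back_flow r t w))"
    by (rule finite_borel_measure.norm_cauchy_quotient_le[OF finite_borel pos]) (use assms in auto)
  also have "\<dots> \<le> mass_bound / (Im z * Im w)"
    using assms mass_le[of r] mass_bound_pos Im_back_flow[of t z r] Im_back_flow[of t w r]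
    by (intro frac_le mult_mono) auto
  finally show ?thesis .
qed

lemma back_flow_Lipschitz:
  assumes "0 \<le> s" "s \<le> t" "Im z > 0" "Im w > 0"
  shows "norm (back_flow s t z - back_flow s t w) \<le> norm (z - w) * exp (mass_bound / (Im z * Im w) * t)"
proof (rule back_flow_diff[OF assms])
  fix B assume B: "B t = 0" "\<And>r. r \<in> {s..t} \<Longrightarrow> (B has_vector_derivative
       - cauchy_quotient (\<mu> r) (back_flow r t z) (back_flow r t w)) (at r within {s..t})"
    "\<And>r. r \<in> {s..t} \<Longrightarrow> back_flow r t z - back_flow r t w = (z - w) * exp (B r)"
  have "norm (B t - B s) \<le> mass_bound / (Im z * Im w) * (t - s)"
    by (rule norm_increment_le[OF assms(2) B(2)])
      (use assms norm_cauchy_quotient_back_flow_le in auto)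
  also have "\<dots> \<le> mass_bound / (Im z * Im w) * t"
    using assms mass_bound_pos by (intro mult_left_mono) auto
  finally have "norm (exp (B s)) \<le> exp (mass_bound / (Im z * Im w) * t)"
    using norm_exp[of "B s"] B(1) by (auto intro: order_trans)
  then show ?thesis
    using B(3)[of s] assms by (simp add: norm_mult mult_left_mono)
qed

lemma back_flow_displacement:
  assumes "0 \<le> s" "s \<le> t" "Im w > 0"
  shows "norm (back_flow s t w - w) \<le> mass_bound * t / Im w"
proof -
  have "0 \<le> t" using assms by simp
  have "norm (back_flow t t w - back_flow s t w) \<le> mass_bound / Im w * (t - s)"
  proof (rule norm_increment_le[OF assms(2)])
    fix r assume r: "r \<in> {s..t}"
    then have "0 \<le> r" "r \<le> t" using assms by auto
    have pos: "Im (back_flow r t w) > 0" using back_flow_pos[OF \<open>0 \<le> t\<close>] assms r by auto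
    show "((\<lambda>s. back_flow s t w) has_vector_derivative cauchy_transform (\<mu> r) (back_flow r t w)) (at r within {s..t})"
    proof (rule has_vector_derivative_within_subset)
      show "((\<lambda>s. back_flow s t w) has_vector_derivative cauchy_transform (\<mu> r) (back_flow r t w)) (at r within {0..})"
        using flow_line_back_flow[OF \<open>0 \<le> t\<close> assms(3)] \<open>0 \<le> r\<close> \<open>r \<le> t\<close> by (simp add: flow_line_def)
    qed (use assms(1) in auto)
    have "norm (cauchy_transform (\<mu> r) (back_flow r t w)) \<le> measure (\<mu> r) UNIV / Im (back_flow r t w)"
      by (rule finite_borel_measure.norm_cauchy_transform_le[OF finite_borel[OF \<open>0 \<le> r\<close>] pos])
    also have "\<dots> \<le> mass_bound / Im w"
      using mass_le[OF \<open>0 \<le> r\<close>] mass_bound_pos Im_back_flow[OF \<open>0 \<le> t\<close> assms(3) \<open>r \<le> t\<close>] assms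
      by (intro frac_le) auto
    finally show "norm (cauchy_transform (\<mu> r) (back_flow r t w)) \<le> mass_bound / Im w" .
  qed
  also have "\<dots> \<le> mass_bound / Im w * t" using assms mass_bound_pos by (intro mult_left_mono) auto
  finally show ?thesis by (simp add: back_flow_end \<open>0 \<le> t\<close> assms norm_minus_commute)
qed

text \<open>
  The difference quotient equals \<open>exp (B z s)\<close> exactly, where \<open>B z\<close> is the primitive that vanishes at \<open>t\<close> of
  the negated divided difference along the solutions through \<open>z\<close> and \<open>w\<close>.  By Lipschitz
  dependence \<open>B z s\<close> tends to \<open>B w s\<close>, so the derivative is \<open>exp (B w s)\<close>.
\<close>
lemma back_flow_has_derivative:
  assumes "0 \<le> s" "s \<le> t" "Im w > 0"
  obtains D where "(back_flow s t has_field_derivative D) (at w)"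
proof -
  have "\<exists>B. B t = 0 \<and>
    (\<forall>r\<in>{s..t}. (B has_vector_derivative
       - cauchy_quotient (\<mu> r) (back_flow r t z) (back_flow r t w)) (at r within {s..t})) \<and>
    (\<forall>r\<in>{s..t}. back_flow r t z - back_flow r t w = (z - w) * exp (B r))" if "Im z > 0" for z
    using back_flow_diff[OF assms(1,2) that assms(3)] by metis
  then obtain B where Bt: "\<And>z. Im z > 0 \<Longrightarrow> B z t = 0"
    and B': "\<And>z r. Im z > 0 \<Longrightarrow> r \<in> {s..t} \<Longrightarrow> (B z has_vector_derivative
       - cauchy_quotient (\<mu> r) (back_flow r t z) (back_flow r t w)) (at r within {s..t})"
    and Beq: "\<And>z r. Im z > 0 \<Longrightarrow> r \<in> {s..t} \<Longrightarrow>
       back_flow r t z - back_flow r t w = (z - w) * exp (B z r)" by metis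
  have "0 \<le> t" using assms by simp
  define E where "E z = mass_bound * (norm (z - w) * exp (mass_bound / (Im z * Im w) * t))
      / (Im z * Im w * Im w) * (t - s)" for z
  have bound: "norm (B z s - B w s) \<le> E z" if z: "Im z > 0" for z
  proof -
    have "norm ((B z t - B w t) - (B z s - B w s)) \<le> E z"
      unfolding E_def
    proof (rule norm_increment_le[OF assms(2) has_vector_derivative_diff[OF B'[OF z] B'[OF assms(3)]]])
      fix r assume r: "r \<in> {s..t}"
      then have "0 \<le> r" "r \<le> t" using assms by auto
      have pos: "Im (back_flow r t z) > 0" "Im (back_flow r t w) > 0"
        using back_flow_pos \<open>0 \<le> t\<close> \<open>r \<le> t\<close> assms(3) z by auto
      have "norm (cauchy_quotient (\<mu> r) (back_flow r t z) (back_flow r t w)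
             - cauchy_quotient (\<mu> r) (back_flow r t w) (back_flow r t w))
          \<le> measure (\<mu> r) UNIV * norm (back_flow r t z - back_flow r t w)
             / (Im (back_flow r t z) * Im (back_flow r t w) * Im (back_flow r t w))"
        by (rule finite_borel_measure.norm_cauchy_quotient_diff_le[OF finite_borel[OF \<open>0 \<le> r\<close>] pos pos(2)])
      also have "\<dots> \<le> mass_bound * (norm (z - w) * exp (mass_bound / (Im z * Im w) * t)) / (Im z * Im w * Im w)"
        using mass_le[OF \<open>0 \<le> r\<close>] mass_bound_pos assms(3) z pos
          Im_back_flow[OF \<open>0 \<le> t\<close> z \<open>r \<le> t\<close>] Im_back_flow[OF \<open>0 \<le> t\<close> assms(3) \<open>r \<le> t\<close>]
          back_flow_Lipschitz[OF \<open>0 \<le> r\<close> \<open>r \<le> t\<close> z assms(3)]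
        by (intro frac_le mult_mono) auto
      finally show "norm (- cauchy_quotient (\<mu> r) (back_flow r t z) (back_flow r t w)
             - - cauchy_quotient (\<mu> r) (back_flow r t w) (back_flow r t w))
          \<le> mass_bound * (norm (z - w) * exp (mass_bound / (Im z * Im w) * t)) / (Im z * Im w * Im w)"
        by (simp add: norm_minus_commute)
    qed
    then show ?thesis by (simp add: Bt z assms norm_minus_commute)
  qed
  have ev: "eventually (\<lambda>z. Im z > 0) (at w)"
    using assms by (intro order_tendstoD(1)[of Im]) (auto intro!: tendsto_intros)
  have "isCont E w"
    unfolding E_def by (intro continuous_intros) (use assms(3) in auto)
  then have lim: "(E \<longlongrightarrow> 0) (at w)"
    by (simp add: isCont_def) (simp add: E_def)
  have "eventually (\<lambda>z. norm (B z s - B w s) \<le> E z) (at w)"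
    using ev by eventually_elim (rule bound)
  from Lim_null_comparison[OF this lim]
  have "((\<lambda>z. B z s - B w s) \<longlongrightarrow> 0) (at w)" .
  then have "((\<lambda>z. exp (B z s)) \<longlongrightarrow> exp (B w s)) (at w)"
    by (intro tendsto_exp) (simp add: LIM_zero_iff)
  then have "((\<lambda>z. (back_flow s t z - back_flow s t w) / (z - w)) \<longlongrightarrow> exp (B w s)) (at w)"
  proof (rule Lim_transform_eventually)
    have "eventually (\<lambda>z. z \<noteq> w) (at w)" by (simp add: eventually_at_filter)
    with ev show "eventually (\<lambda>z. exp (B z s) = (back_flow s t z - back_flow s t w) / (z - w)) (at w)"
      by eventually_elim (use assms in \<open>simp add: Beq\<close>)
  qed
  then show ?thesis using that by (simp add: has_field_derivative_iff)
qed

lemma conformal_back_flow: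
  assumes "0 \<le> s" "s \<le> t"
  shows "conformal_self_map (back_flow s t)"
  unfolding conformal_self_map_def
proof (intro conjI)
  show "back_flow s t holomorphic_on upper_half_plane"
    unfolding holomorphic_on_def field_differentiable_def
  proof
    fix w assume "w \<in> upper_half_plane"
    then obtain D where "(back_flow s t has_field_derivative D) (at w)"
      using back_flow_has_derivative[OF assms] by auto
    then show "\<exists>D. (back_flow s t has_field_derivative D) (at w within upper_half_plane)"
      using has_field_derivative_at_within by blast
  qed
  show "inj_on (back_flow s t) upper_half_plane"
    using back_flow_inj[OF assms] by (auto intro!: inj_onI)
  show "back_flow s t ` upper_half_plane \<subseteq> upper_half_plane"
    using back_flow_pos assms by auto
qed

end

section \<open>The uniformizing maps as backward flows\<close>

context driving_path
begin

lemma loewner_solution_imp_flow_line: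
  assumes "loewner_solution \<mu> z T \<gamma>" "ereal t < T"
  shows "flow_line \<gamma> {0..t}"
  using assms unfolding loewner_solution_def flow_line_def
  by (metis atLeastAtMost_iff ereal_less_eq(3) le_less_trans)

lemma flow_line_imp_loewner_solution:
  "flow_line \<gamma> {0..t} \<Longrightarrow> \<gamma> 0 = z \<Longrightarrow> loewner_solution \<mu> z (ereal t) \<gamma>"
  unfolding loewner_solution_def flow_line_def by auto

lemma less_loewner_lifetime_iff:
  "ereal t < loewner_lifetime \<mu> z \<longleftrightarrow> (\<exists>T \<gamma>. ereal t < T \<and> loewner_solution \<mu> z T \<gamma>)"
  unfolding loewner_lifetime_def less_Sup_iff by blast

lemma loewner_solution_agree:
  assumes "loewner_solution \<mu> z T \<gamma>" "loewner_solution \<mu> z T' \<delta>"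
    "0 \<le> t" "ereal t < T" "ereal t < T'"
  shows "\<gamma> t = \<delta> t"
  by (rule flow_line_unique_forward[of 0 _ t])
    (use assms loewner_solution_imp_flow_line in \<open>auto simp: loewner_solution_def\<close>)

text \<open>
  The lifetime is a supremum, so a solution on all of \<open>[0, T)\<close> has to be glued from solutions on shorter
  intervals; these agree by uniqueness.
\<close>
lemma maximal_loewner_solution_exists:
  "\<exists>\<gamma>. loewner_solution \<mu> z (loewner_lifetime \<mu> z) \<gamma>"
proof -
  define P where "P t \<gamma> \<longleftrightarrow> (\<exists>T. ereal t < T \<and> loewner_solution \<mu> z T \<gamma>)" for t \<gamma>
  define \<gamma> where "\<gamma> t = (if t = 0 then z else (SOME \<gamma>. P t \<gamma>) t)" for t
  have \<gamma>_eq: "\<gamma> t = \<delta> t" if "loewner_solution \<mu> z T \<delta>" "0 \<le> t" "ereal t < T" for \<delta> T t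
  proof (cases "t = 0")
    case True
    then show ?thesis using that by (simp add: \<gamma>_def loewner_solution_def)
  next
    case False
    have "P t (SOME \<gamma>. P t \<gamma>)" by (rule someI[of _ \<delta>]) (use that in \<open>auto simp: P_def\<close>)
    then obtain T' where "ereal t < T'" "loewner_solution \<mu> z T' (SOME \<gamma>. P t \<gamma>)"
      by (auto simp: P_def)
    from loewner_solution_agree[OF this(2) that(1,2) this(1) that(3)] False show ?thesis
      by (simp add: \<gamma>_def)
  qed
  have "loewner_solution \<mu> z (loewner_lifetime \<mu> z) \<gamma>"
    unfolding loewner_solution_def
  proof (intro conjI allI impI)
    show "\<gamma> 0 = z" by (simp add: \<gamma>_def)
    fix t :: real assume t: "0 \<le> t" "ereal t < loewner_lifetime \<mu> z"
    then obtain T \<delta> where \<delta>: "ereal t < T" "loewner_solution \<mu> z T \<delta>"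
      by (auto simp: less_loewner_lifetime_iff)
    obtain t' where t': "t < t'" "ereal t' < T"
      using ereal_dense2[OF \<delta>(1)] by auto
    have \<delta>t: "\<delta> t \<in> upper_half_plane"
      "(\<delta> has_vector_derivative cauchy_transform (\<mu> t) (\<delta> t)) (at t within {0..})"
      using \<delta> t by (auto simp: loewner_solution_def)
    show "\<gamma> t \<in> upper_half_plane" using \<delta>t(1) \<gamma>_eq[OF \<delta>(2) t(1) \<delta>(1)] by simp
    have "(\<gamma> has_vector_derivative cauchy_transform (\<mu> t) (\<delta> t)) (at t within {0..})"
    proof (rule has_vector_derivative_transform_within[OF \<delta>t(2)])
      show "0 < t' - t" using t' by simp
      fix u assume u: "u \<in> {0..}" "dist u t < t' - t"
      then have "ereal u < T" using t' by (intro le_less_trans[OF _ t'(2)]) (auto simp: dist_real_def)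
      then show "\<delta> u = \<gamma> u" using \<gamma>_eq[OF \<delta>(2)] u by auto
    qed (use t in auto)
    then show "(\<gamma> has_vector_derivative cauchy_transform (\<mu> t) (\<gamma> t)) (at t within {0..})"
      using \<gamma>_eq[OF \<delta>(2) t(1) \<delta>(1)] by simp
  qed
  then show ?thesis by blast
qed

lemma loewner_g_eq:
  assumes "loewner_solution \<mu> z T \<gamma>" "0 \<le> t" "ereal t < T"
  shows "loewner_g \<mu> t z = \<gamma> t"
proof -
  have max: "loewner_solution \<mu> z (loewner_lifetime \<mu> z) (SOME \<gamma>. loewner_solution \<mu> z (loewner_lifetime \<mu> z) \<gamma>)"
    by (rule someI_ex[OF maximal_loewner_solution_exists])
  show ?thesis
    unfolding loewner_g_def
    by (rule loewner_solution_agree[OF max assms(1,2) _ assms(3)])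
      (use assms less_loewner_lifetime_iff in blast)
qed

lemma back_flow_0_solution:
  assumes "0 \<le> t" "Im w > 0"
  shows "ereal t < loewner_lifetime \<mu> (back_flow 0 t w)" "loewner_g \<mu> t (back_flow 0 t w) = w"
proof -
  obtain \<gamma> \<eta> where \<gamma>: "\<eta> > 0" "\<gamma> t = w" "flow_line \<gamma> {0..t + \<eta>}"
    using flow_line_exists[OF assms] by blast
  have "back_flow 0 t w = \<gamma> 0"
    using back_flow_eqI[of 0 t \<gamma>] flow_line_subset[OF \<gamma>(3), of "{0..t}"] \<gamma> assms by auto
  then have sol: "loewner_solution \<mu> (back_flow 0 t w) (ereal (t + \<eta>)) \<gamma>"
    using flow_line_imp_loewner_solution \<gamma> by simp
  show "ereal t < loewner_lifetime \<mu> (back_flow 0 t w)"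
    unfolding less_loewner_lifetime_iff using sol \<gamma>(1) by (intro exI[of _ "ereal (t + \<eta>)"]) auto
  show "loewner_g \<mu> t (back_flow 0 t w) = w"
    using loewner_g_eq[OF sol assms(1)] \<gamma> by simp
qed

lemma surviving_points_eq:
  assumes "0 \<le> t"
  shows "{z \<in> upper_half_plane. ereal t < loewner_lifetime \<mu> z} = back_flow 0 t ` upper_half_plane"
proof (intro equalityI subsetI)
  fix z assume "z \<in> {z \<in> upper_half_plane. ereal t < loewner_lifetime \<mu> z}"
  then obtain T \<gamma> where T: "ereal t < T" "loewner_solution \<mu> z T \<gamma>"
    by (auto simp: less_loewner_lifetime_iff)
  then have "flow_line \<gamma> {0..t}" using loewner_solution_imp_flow_line by blast
  then have "back_flow 0 t (\<gamma> t) = \<gamma> 0" "\<gamma> t \<in> upper_half_plane"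
    using back_flow_eqI[of 0 t \<gamma>] assms by (auto simp: flow_line_def)
  moreover have "\<gamma> 0 = z" using T by (simp add: loewner_solution_def)
  ultimately show "z \<in> back_flow 0 t ` upper_half_plane" by (metis imageI)
qed (use back_flow_0_solution back_flow_pos assms in auto)

text \<open>
  Taking the closure in the definition of the hull adds no points of the upper half-plane: the set of
  surviving points is the image of an injective holomorphic map, hence open.
\<close>
lemma complement_loewner_hull:
  assumes "0 \<le> t"
  shows "upper_half_plane - loewner_hull \<mu> t = back_flow 0 t ` upper_half_plane"
proof -
  let ?O = "back_flow 0 t ` upper_half_plane"
  let ?K = "{z \<in> upper_half_plane. loewner_lifetime \<mu> z \<le> ereal t}"
  have "open upper_half_plane"
    unfolding upper_half_plane_def by (simp add: open_halfspace_Im_gt)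
  then have "open ?O"
    using conformal_back_flow[of 0 t] assms open_mapping_thm3 by (auto simp: conformal_self_map_def)
  have K: "?K = upper_half_plane - ?O"
    unfolding surviving_points_eq[OF assms, symmetric] by auto
  have "closure ?K \<inter> ?O = {}"
    using open_Int_closure_eq_empty[OF \<open>open ?O\<close>, of ?K] K by auto
  moreover have "?K \<subseteq> closure ?K" by (rule closure_subset)
  moreover have "?O \<subseteq> upper_half_plane" using surviving_points_eq[OF assms] by auto
  ultimately show ?thesis unfolding loewner_hull_def using K by auto
qed

text \<open>
  The forward map \<open>g\<^sub>t\<close> undoes the backward flow from time \<open>t\<close>, and the complement of the hull is the
  image of that flow.
\<close>
lemma loewner_f_eq_back_flow:
  assumes "0 \<le> t" "Im w > 0"
  shows "loewner_f \<mu> t w = back_flow 0 t w"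
  unfolding loewner_f_def complement_loewner_hull[OF assms(1)]
proof (rule the_inv_into_f_eq)
  show "inj_on (loewner_g \<mu> t) (back_flow 0 t ` upper_half_plane)"
    using back_flow_0_solution(2)[OF assms(1)] by (auto intro!: inj_onI)
qed (use back_flow_0_solution(2)[OF assms] assms in auto)

lemma loewner_G_eq: "0 \<le> t \<Longrightarrow> Im w > 0 \<Longrightarrow> loewner_G \<mu> t w = 1 / back_flow 0 t w"
  by (simp add: loewner_G_def loewner_f_eq_back_flow)

lemma loewner_G_back_flow:
  assumes "0 \<le> s" "s \<le> t" "Im w > 0"
  shows "loewner_G \<mu> s (back_flow s t w) = loewner_G \<mu> t w"
  using assms back_flow_pos[of t w s] by (simp add: loewner_G_eq back_flow_back_flow)

lemma loewner_G_factor_unique: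
  assumes "0 \<le> s" "s \<le> t" "Im w > 0" "Im z > 0" "loewner_G \<mu> s z = loewner_G \<mu> t w"
  shows "z = back_flow s t w"
proof (rule back_flow_inj[of 0 s])
  have "1 / back_flow 0 s z = 1 / back_flow 0 s (back_flow s t w)"
    using assms back_flow_pos[of t w s] loewner_G_back_flow[OF assms(1-3)] by (simp add: loewner_G_eq)
  then show "back_flow 0 s z = back_flow 0 s (back_flow s t w)" by simp
qed (use assms back_flow_pos in auto)

end

section \<open>The Poisson formula in the upper half-plane\<close>

definition poisson_kernel :: "complex \<Rightarrow> real \<Rightarrow> real" where
  "poisson_kernel z u = Im z / ((Re z - u)\<^sup>2 + (Im z)\<^sup>2)"

lemma poisson_kernel_nonneg: "Im z > 0 \<Longrightarrow> 0 \<le> poisson_kernel z u"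
  by (simp add: poisson_kernel_def)

lemma poisson_kernel_denom_pos: "Im z > 0 \<Longrightarrow> (Re z - u)\<^sup>2 + (Im z)\<^sup>2 > 0"
  by (simp add: add_nonneg_pos)

lemma continuous_poisson_kernel: "Im z > 0 \<Longrightarrow> continuous_on UNIV (poisson_kernel z)"
  unfolding poisson_kernel_def
  by (intro continuous_intros) (use poisson_kernel_denom_pos in \<open>simp add: order_less_imp_not_eq2\<close>)

lemma poisson_kernel_measurable [measurable]: "Im z > 0 \<Longrightarrow> poisson_kernel z \<in> borel_measurable borel"
  by (intro borel_measurable_continuous_onI continuous_poisson_kernel)

lemma poisson_kernel_le:
  assumes "Im z > 0"
  shows "poisson_kernel z u \<le> 1 / Im z"
proof -
  have "poisson_kernel z u \<le> Im z / (Im z)\<^sup>2"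
    unfolding poisson_kernel_def using assms by (intro divide_left_mono) (auto simp: add_nonneg_pos)
  then show ?thesis using assms by (simp add: power2_eq_square)
qed

lemma (in finite_borel_measure) Im_cauchy_transform_poisson:
  "Im z > 0 \<Longrightarrow> Im (cauchy_transform M z) = - (\<integral>x. poisson_kernel z x \<partial>M)"
  by (simp add: Im_cauchy_transform poisson_kernel_def)

lemma
  assumes "Im z > 0"
  shows integrable_poisson_kernel: "integrable lborel (poisson_kernel z)"
    and integral_poisson_kernel: "(\<integral>u. poisson_kernel z u \<partial>lborel) = pi"
proof -
  let ?F = "\<lambda>u. arctan ((u - Re z) / Im z)"
  have deriv: "(?F has_real_derivative poisson_kernel z u) (at u)" for u
  proof -
    have "inverse (1 + ((u - Re z) / Im z)\<^sup>2) * (1 / Im z) = poisson_kernel z u"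
      using assms poisson_kernel_denom_pos[OF assms, of u]
      by (simp add: poisson_kernel_def divide_simps power2_eq_square) (simp add: algebra_simps)
    then show ?thesis
      using assms by (auto intro!: derivative_eq_intros simp: divide_inverse)
  qed
  have top: "(?F \<longlongrightarrow> pi / 2) at_top"
    by (rule filterlim_compose[OF tendsto_arctan_at_top])
      (use assms in real_asymp)
  have bot: "(?F \<longlongrightarrow> - (pi / 2)) at_bot"
    by (rule filterlim_compose[OF tendsto_arctan_at_bot])
      (use assms in real_asymp)
  have "isCont (poisson_kernel z) u" for u
    using continuous_poisson_kernel[OF assms] by (simp add: continuous_on_eq_continuous_at)
  note FTC = interval_integral_FTC_nonneg[of "-\<infinity>" \<infinity> ?F "poisson_kernel z" "- (pi / 2)" "pi / 2",
      OF _ deriv this]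
  have "set_integrable lborel (einterval (-\<infinity>) \<infinity>) (poisson_kernel z)"
    "(LBINT u=-\<infinity>..\<infinity>. poisson_kernel z u) = pi / 2 - - (pi / 2)"
    by (rule FTC; use assms poisson_kernel_nonneg top bot in \<open>simp add: ereal_tendsto_simps\<close>)+
  then show "integrable lborel (poisson_kernel z)" "(\<integral>u. poisson_kernel z u \<partial>lborel) = pi"
    by (simp_all add: set_integrable_def interval_lebesgue_integral_def set_lebesgue_integral_def)
qed

lemma tendsto_integral_symmetric_interval:
  fixes f :: "real \<Rightarrow> complex"
  assumes "integrable lborel f"
  shows "(\<lambda>n. integral {- real n..real n} f) \<longlonglongrightarrow> (\<integral>u. f u \<partial>lborel)"
proof -
  have set_int: "set_integrable lborel {- real n..real n} f" for n
    unfolding set_integrable_def using assms by (intro integrable_mult_indicator) auto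
  have "(\<lambda>n. \<integral>u. indicator {- real n..real n} u *\<^sub>R f u \<partial>lborel) \<longlonglongrightarrow> (\<integral>u. f u \<partial>lborel)"
  proof (rule integral_dominated_convergence[where w = "\<lambda>u. norm (f u)"])
    show "AE u in lborel. (\<lambda>n. indicator {- real n..real n} u *\<^sub>R f u) \<longlonglongrightarrow> f u"
    proof (intro AE_I2 tendsto_eventually)
      fix u :: real
      obtain N :: nat where "\<bar>u\<bar> \<le> real N" using real_arch_simple by blast
      then have "indicator {- real n..real n} u *\<^sub>R f u = f u" if "n \<ge> N" for n
        using that by (auto simp: indicator_def abs_le_iff)
      then show "\<forall>\<^sub>F n in sequentially. indicator {- real n..real n} u *\<^sub>R f u = f u"
        by (auto simp: eventually_sequentially)
    qed
  qed (use assms in \<open>auto simp: indicator_def\<close>)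
  then show ?thesis
    using set_borel_integral_eq_integral(2)[OF set_int] by (simp add: set_lebesgue_integral_def)
qed

text \<open>
  Cauchy's theorem is applied to \<open>(G \<zeta> - G z) Im z / ((\<zeta> - z) (\<zeta> - cnj z))\<close>.  Subtracting \<open>G z\<close>
  removes the pole at \<open>z\<close>, and \<open>cnj z\<close> lies outside the contour, so no winding number has to be
  computed.  On the real line the factor of \<open>G \<zeta> - G z\<close> is the Poisson kernel, whose integral is
  \<open>\<pi>\<close>; this accounts for \<open>G z\<close>.
\<close>
proposition poisson_formula_half_plane:
  fixes G :: "complex \<Rightarrow> complex"
  assumes holo: "G holomorphic_on {z. Im z > - \<delta>}" and "\<delta> > 0"
    and bound: "\<And>z. Im z \<ge> 0 \<Longrightarrow> norm (G z) \<le> B" and z: "Im z > 0"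
  shows "(\<integral>u. poisson_kernel z u *\<^sub>R G (complex_of_real u) \<partial>lborel) = pi * G z"
proof -
  define d where "d = min \<delta> (Im z)"
  have "d > 0" using \<open>\<delta> > 0\<close> z by (simp add: d_def)
  define S where "S = {\<zeta>. Im \<zeta> > - d}"
  have "open S" "convex S"
    unfolding S_def by (simp_all add: open_halfspace_Im_gt convex_halfspace_Im_gt)
  have "B \<ge> 0" using bound[of z] z norm_ge_zero[of "G z"] by (smt (verit))
  define q where "q \<zeta> = (if \<zeta> = z then deriv G z else (G \<zeta> - G z) / (\<zeta> - z))" for \<zeta>
  define f where "f \<zeta> = q \<zeta> * (Im z / (\<zeta> - cnj z))" for \<zeta>
  have "q holomorphic_on S"
    unfolding q_def using \<open>open S\<close>
    by (intro pole_lemma_open holomorphic_on_subset[OF holo]) (auto simp: S_def d_def)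
  then have f_holo: "f holomorphic_on S"
    unfolding f_def by (intro holomorphic_intros) (auto simp: S_def d_def)
  have f_real: "f (complex_of_real u) = poisson_kernel z u *\<^sub>R (G (complex_of_real u) - G z)" for u
  proof -
    have ne: "complex_of_real u \<noteq> z" using z by auto
    have "(complex_of_real u - z) * (complex_of_real u - cnj z) = complex_of_real ((Re z - u)\<^sup>2 + (Im z)\<^sup>2)"
      by (simp add: complex_eq_iff power2_eq_square algebra_simps)
    with ne show ?thesis
      by (simp add: f_def q_def poisson_kernel_def scaleR_conv_of_real field_simps del: of_real_add of_real_power)
  qed
  have int: "integrable lborel (\<lambda>u. f (complex_of_real u))"
  proof (rule Bochner_Integration.integrable_bound)
    show "integrable lborel (\<lambda>u. 2 * B * poisson_kernel z u)"
      using integrable_poisson_kernel[OF z] by simp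
    have "continuous_on UNIV (\<lambda>u. f (complex_of_real u))"
      by (rule continuous_on_compose2[OF holomorphic_on_imp_continuous_on[OF f_holo]])
        (use \<open>d > 0\<close> in \<open>auto simp: S_def intro!: continuous_intros\<close>)
    then show "(\<lambda>u. f (complex_of_real u)) \<in> borel_measurable lborel"
      using borel_measurable_continuous_onI by auto
    have "norm (f (complex_of_real u)) \<le> 2 * B * poisson_kernel z u" for u
    proof -
      have "norm (G (complex_of_real u) - G z) \<le> 2 * B"
        using norm_triangle_ineq4[of "G (complex_of_real u)" "G z"] bound[of "complex_of_real u"] bound[of z] z by auto
      then show ?thesis
        using poisson_kernel_nonneg[OF z, of u] unfolding f_real by (simp add: mult_left_mono mult.commute)
    qed
    then show "AE u in lborel. norm (f (complex_of_real u)) \<le> norm (2 * B * poisson_kernel z u)"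
      by (smt (verit, best) AE_I2 norm_ge_zero real_norm_def)
  qed
  \<comment> \<open>the half-disc of radius \<open>n\<close>: by Cauchy's theorem the segment and the arc cancel, and
    the arc has length \<open>\<pi> n\<close> while the integrand is \<open>O(1/n\<^sup>2)\<close> on it\<close>
  have bound_n: "norm (integral {- real n..real n} (\<lambda>u. f (complex_of_real u))) \<le> 8 * B * Im z * pi / real n"
    if n: "real n \<ge> 2 * norm z" "n > 0" for n
  proof -
    let ?L = "linepath (complex_of_real (- real n)) (complex_of_real (real n))"
    let ?A = "part_circlepath 0 (real n) 0 pi"
    have A_img: "Im \<zeta> \<ge> 0" "norm \<zeta> = real n" if "\<zeta> \<in> path_image ?A" for \<zeta>
    proof -
      show "norm \<zeta> = real n" using in_path_image_part_circlepath[OF that] by simp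
      show "Im \<zeta> \<ge> 0" using that
        by (auto simp: path_image_part_circlepath' closed_segment_eq_real_ivl sin_ge_zero)
    qed
    have A_S: "path_image ?A \<subseteq> S" using A_img(1) \<open>d > 0\<close> by (force simp: S_def)
    have L_S: "path_image ?L \<subseteq> S"
      using \<open>convex S\<close> \<open>d > 0\<close> by (simp add: closed_segment_subset S_def)
    have A_int: "f contour_integrable_on ?A"
      by (rule contour_integrable_holomorphic_simple[OF f_holo \<open>open S\<close> _ A_S]) auto
    have L_int: "f contour_integrable_on ?L"
      by (rule contour_integrable_holomorphic_simple[OF f_holo \<open>open S\<close> _ L_S]) auto
    have join: "pathfinish ?L = pathstart ?A" "pathfinish ?A = pathstart ?L"
      by (simp_all add: exp_eq_polar)
    have "(f has_contour_integral 0) (?L +++ ?A)"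
      by (rule Cauchy_theorem_convex_simple[OF f_holo \<open>convex S\<close>])
        (use join A_S L_S in \<open>auto simp: valid_path_join path_image_join\<close>)
    then have "contour_integral ?L f + contour_integral ?A f = 0"
      using contour_integral_join[OF L_int A_int] contour_integral_unique by fastforce
    then have "norm (contour_integral ?L f) = norm (contour_integral ?A f)"
      by (metis add_eq_0_iff norm_minus_cancel)
    also have "\<dots> \<le> (8 * B * Im z / (real n)\<^sup>2) * real n * (pi - 0)"
    proof (rule has_contour_integral_bound_part_circlepath[OF has_contour_integral_integral[OF A_int]])
      fix \<zeta> assume "\<zeta> \<in> path_image ?A"
      note \<zeta> = A_img[OF this]
      have "norm (\<zeta> - z) \<ge> real n / 2" "norm (\<zeta> - cnj z) \<ge> real n / 2"
        using norm_triangle_ineq2[of \<zeta> z] norm_triangle_ineq2[of \<zeta> "cnj z"] n \<zeta>(2) by auto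
      then have "(real n / 2) * (real n / 2) \<le> norm (\<zeta> - z) * norm (\<zeta> - cnj z)"
        by (intro mult_mono) auto
      moreover have "\<zeta> \<noteq> z" using \<zeta>(2) n by auto
      moreover have "norm (G \<zeta> - G z) \<le> 2 * B"
        using norm_triangle_ineq4[of "G \<zeta>" "G z"] bound[OF \<zeta>(1)] bound[of z] z by auto
      ultimately have "norm (G \<zeta> - G z) * Im z / (norm (\<zeta> - z) * norm (\<zeta> - cnj z))
          \<le> 2 * B * Im z / ((real n / 2) * (real n / 2))"
        using n z \<open>B \<ge> 0\<close> by (intro frac_le mult_right_mono) auto
      moreover have "norm (f \<zeta>) = norm (G \<zeta> - G z) * Im z / (norm (\<zeta> - z) * norm (\<zeta> - cnj z))"
        using \<open>\<zeta> \<noteq> z\<close> z by (simp add: f_def q_def norm_mult norm_divide)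
      ultimately have "norm (f \<zeta>) \<le> 2 * B * Im z / ((real n / 2) * (real n / 2))"
        by simp
      then show "norm (f \<zeta>) \<le> 8 * B * Im z / (real n)\<^sup>2"
        by (simp add: power2_eq_square)
    qed (use \<open>B \<ge> 0\<close> z n in auto)
    also have "\<dots> = 8 * B * Im z * pi / real n"
      using n by (simp add: power2_eq_square)
    also have "contour_integral ?L f = integral {- real n..real n} (\<lambda>u. f (complex_of_real u))"
      using n by (subst contour_integral_linepath_Reals_eq) auto
    finally show ?thesis .
  qed
  have "(\<lambda>n. integral {- real n..real n} (\<lambda>u. f (complex_of_real u))) \<longlonglongrightarrow> 0"
  proof (rule Lim_null_comparison)
    show "(\<lambda>n. 8 * B * Im z * pi / real n) \<longlonglongrightarrow> 0"
      by (rule lim_const_over_n)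
    obtain N :: nat where N: "2 * norm z \<le> real N" using real_arch_simple by blast
    have "norm (integral {- real n..real n} (\<lambda>u. f (complex_of_real u))) \<le> 8 * B * Im z * pi / real n"
      if "n \<ge> Suc N" for n
      using bound_n[of n] that N by simp
    then show "\<forall>\<^sub>F n in sequentially. norm (integral {- real n..real n} (\<lambda>u. f (complex_of_real u)))
        \<le> 8 * B * Im z * pi / real n"
      by (auto simp: eventually_sequentially)
  qed
  with tendsto_integral_symmetric_interval[OF int] have zero: "(\<integral>u. f (complex_of_real u) \<partial>lborel) = 0"
    using LIMSEQ_unique by blast
  have const: "integrable lborel (\<lambda>u. poisson_kernel z u *\<^sub>R G z)"
    using integrable_poisson_kernel[OF z] by simp
  have "(\<integral>u. poisson_kernel z u *\<^sub>R G (complex_of_real u) \<partial>lborel)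
      = (\<integral>u. f (complex_of_real u) + poisson_kernel z u *\<^sub>R G z \<partial>lborel)"
    by (simp add: f_real scaleR_diff_right)
  also have "\<dots> = (\<integral>u. poisson_kernel z u *\<^sub>R G z \<partial>lborel)"
    by (simp add: Bochner_Integration.integral_add[OF int const] zero)
  also have "\<dots> = pi * G z"
    using integral_poisson_kernel[OF z] by (simp add: scaleR_conv_of_real)
  finally show ?thesis .
qed

section \<open>Characterization of Cauchy transforms of probability measures\<close>

lemma imaginary_axis_mass_le:
  assumes "\<And>z. Im z > 0 \<Longrightarrow> norm (G z) \<le> 1 / Im z" "y > 0"
  shows "- y * Im (G (\<i> * of_real y)) \<le> 1"
proof -
  have "norm (G (\<i> * of_real y)) \<le> 1 / y" using assms(1)[of "\<i> * of_real y"] assms(2) by simp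
  then have "- Im (G (\<i> * of_real y)) \<le> 1 / y"
    using abs_Im_le_cmod[of "G (\<i> * of_real y)"] by linarith
  then show ?thesis using assms(2) by (simp add: field_simps)
qed

text \<open>
  On the line at height \<open>\<epsilon>\<close> the function is bounded and holomorphic across the line, so Poisson's
  formula recovers \<open>Im G\<close> above that line from the density \<open>- Im G(u + \<i> \<epsilon>) / \<pi>\<close>.
\<close>
lemma poisson_density_distribution:
  fixes G :: "complex \<Rightarrow> complex"
  assumes holo: "G holomorphic_on upper_half_plane"
    and Im_G: "\<And>z. Im z > 0 \<Longrightarrow> Im (G z) \<le> 0"
    and bound: "\<And>z. Im z > 0 \<Longrightarrow> norm (G z) \<le> 1 / Im z"
    and mass: "((\<lambda>y. - y * Im (G (\<i> * of_real y))) \<longlongrightarrow> 1) at_top"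
    and "\<epsilon> > 0"
  obtains \<nu> where "real_distribution \<nu>"
    "\<And>z. Im z > 0 \<Longrightarrow> (\<integral>u. poisson_kernel z u \<partial>\<nu>) = - Im (G (z + \<i> * of_real \<epsilon>))"
proof -
  define G\<epsilon> where "G\<epsilon> z = G (z + \<i> * of_real \<epsilon>)" for z
  have holo_\<epsilon>: "G\<epsilon> holomorphic_on {z. Im z > - \<epsilon>}"
    unfolding G\<epsilon>_def using holo
    by (intro holomorphic_on_compose_gen[of "\<lambda>z. z + \<i> * of_real \<epsilon>" _ G, unfolded o_def] holomorphic_intros) auto
  have bound_\<epsilon>: "norm (G\<epsilon> z) \<le> 1 / \<epsilon>" if "Im z \<ge> 0" for z
  proof -
    have "norm (G\<epsilon> z) \<le> 1 / (Im z + \<epsilon>)"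
      using bound[of "z + \<i> * of_real \<epsilon>"] that \<open>\<epsilon> > 0\<close> by (simp add: G\<epsilon>_def)
    also have "\<dots> \<le> 1 / \<epsilon>" using that \<open>\<epsilon> > 0\<close> by (intro divide_left_mono) auto
    finally show ?thesis .
  qed
  define p where "p u = - Im (G\<epsilon> (complex_of_real u)) / pi" for u
  have p_nonneg: "0 \<le> p u" for u
    using Im_G[of "complex_of_real u + \<i> * of_real \<epsilon>"] \<open>\<epsilon> > 0\<close> by (simp add: p_def G\<epsilon>_def divide_nonpos_pos)
  have cont_G\<epsilon>: "continuous_on UNIV (\<lambda>u. G\<epsilon> (complex_of_real u))"
    by (rule continuous_on_compose2[OF holomorphic_on_imp_continuous_on[OF holo_\<epsilon>]])
      (use \<open>\<epsilon> > 0\<close> in \<open>auto intro!: continuous_intros\<close>)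
  then have "continuous_on UNIV p" unfolding p_def by (intro continuous_intros) auto
  then have p_meas [measurable]: "p \<in> borel_measurable borel" by (rule borel_measurable_continuous_onI)
  have int: "integrable lborel (\<lambda>u. poisson_kernel z u *\<^sub>R G\<epsilon> (complex_of_real u))" if "Im z > 0" for z
  proof (rule Bochner_Integration.integrable_bound)
    show "integrable lborel (\<lambda>u. 1 / \<epsilon> * poisson_kernel z u)"
      using integrable_poisson_kernel[OF that] by simp
    show "(\<lambda>u. poisson_kernel z u *\<^sub>R G\<epsilon> (complex_of_real u)) \<in> borel_measurable lborel"
      using borel_measurable_continuous_onI[OF continuous_on_scaleR[OF continuous_poisson_kernel[OF that] cont_G\<epsilon>]] by simp
    have "norm (poisson_kernel z u *\<^sub>R G\<epsilon> (complex_of_real u)) \<le> norm (1 / \<epsilon> * poisson_kernel z u)" for u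
    proof -
      have "\<bar>poisson_kernel z u\<bar> * norm (G\<epsilon> (complex_of_real u)) \<le> \<bar>poisson_kernel z u\<bar> * (1 / \<epsilon>)"
        by (intro mult_left_mono bound_\<epsilon>) auto
      then show ?thesis using \<open>\<epsilon> > 0\<close> by (simp add: abs_mult)
    qed
    then show "AE u in lborel. norm (poisson_kernel z u *\<^sub>R G\<epsilon> (complex_of_real u)) \<le> norm (1 / \<epsilon> * poisson_kernel z u)"
      by blast
  qed
  have poisson: "integrable lborel (\<lambda>u. p u * poisson_kernel z u)"
    "(\<integral>u. p u * poisson_kernel z u \<partial>lborel) = - Im (G\<epsilon> z)" if z: "Im z > 0" for z
  proof -
    have eq: "p u * poisson_kernel z u = - (1 / pi) * Im (poisson_kernel z u *\<^sub>R G\<epsilon> (complex_of_real u))" for u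
      by (simp add: p_def)
    show "integrable lborel (\<lambda>u. p u * poisson_kernel z u)"
      unfolding eq by (intro integrable_mult_right integrable_Im int z)
    have "(\<integral>u. p u * poisson_kernel z u \<partial>lborel)
        = - (1 / pi) * Im (\<integral>u. poisson_kernel z u *\<^sub>R G\<epsilon> (complex_of_real u) \<partial>lborel)"
      unfolding eq integral_mult_right_zero integral_Im[OF int[OF z]] ..
    also have "\<dots> = - Im (G\<epsilon> z)"
      using arg_cong[OF poisson_formula_half_plane[OF holo_\<epsilon> \<open>\<epsilon> > 0\<close> bound_\<epsilon> z], of Im] by simp
    finally show "(\<integral>u. p u * poisson_kernel z u \<partial>lborel) = - Im (G\<epsilon> z)" .
  qed
  \<comment> \<open>\<open>y\<close> times the Poisson kernel at \<open>\<i> y\<close> increases to \<open>1\<close>, so the total mass is read off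
    from the behaviour of \<open>G\<close> at \<open>\<i> \<infinity>\<close>\<close>
  define h where "h n u = real (Suc n) * poisson_kernel (\<i> * of_real (real (Suc n))) u" for n u
  have h_eq: "h n u = 1 - u\<^sup>2 / (u\<^sup>2 + (real (Suc n))\<^sup>2)" for n u
    by (simp add: h_def poisson_kernel_def divide_simps power2_eq_square add_nonneg_pos)
  have total: "(\<integral>\<^sup>+u. ennreal (p u) \<partial>lborel) = 1"
  proof (rule LIMSEQ_unique)
    show "(\<lambda>n. \<integral>\<^sup>+u. ennreal (p u * h n u) \<partial>lborel) \<longlonglongrightarrow> (\<integral>\<^sup>+u. ennreal (p u) \<partial>lborel)"
    proof (rule nn_integral_LIMSEQ)
      show "incseq (\<lambda>n u. ennreal (p u * h n u))"
        unfolding incseq_def le_fun_def h_eq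
        by (auto intro!: ennreal_leI mult_left_mono p_nonneg divide_left_mono power_mono add_left_mono
            simp: add_nonneg_pos)
      show "(\<lambda>u. ennreal (p u * h n u)) \<in> borel_measurable lborel" for n
        unfolding h_def by measurable
      fix u
      have "(\<lambda>n. h n u) \<longlonglongrightarrow> 1"
        unfolding h_eq by real_asymp
      then show "(\<lambda>n. ennreal (p u * h n u)) \<longlonglongrightarrow> ennreal (p u)"
        by (intro tendsto_ennrealI) (auto intro: tendsto_eq_intros)
    qed
    have "(\<integral>\<^sup>+u. ennreal (p u * h n u) \<partial>lborel)
        = ennreal (- real (Suc n) * Im (G (\<i> * of_real (real (Suc n) + \<epsilon>))))" for n
    proof -
      let ?z = "\<i> * of_real (real (Suc n))"
      have "(\<integral>\<^sup>+u. ennreal (p u * h n u) \<partial>lborel) = (\<integral>\<^sup>+u. ennreal (real (Suc n) * (p u * poisson_kernel ?z u)) \<partial>lborel)"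
        by (simp add: h_def ac_simps)
      also have "\<dots> = ennreal (\<integral>u. real (Suc n) * (p u * poisson_kernel ?z u) \<partial>lborel)"
        by (intro nn_integral_eq_integral integrable_mult_right poisson(1))
          (auto intro!: AE_I2 mult_nonneg_nonneg p_nonneg poisson_kernel_nonneg)
      also have "(\<integral>u. real (Suc n) * (p u * poisson_kernel ?z u) \<partial>lborel) = - real (Suc n) * Im (G\<epsilon> ?z)"
        by (subst integral_mult_right_zero, subst poisson(2)) (auto simp: algebra_simps)
      finally show ?thesis by (simp add: G\<epsilon>_def distrib_left)
    qed
    moreover have "(\<lambda>n. ennreal (- real (Suc n) * Im (G (\<i> * of_real (real (Suc n) + \<epsilon>))))) \<longlonglongrightarrow> ennreal 1"
    proof (rule tendsto_ennrealI)
      have "filterlim (\<lambda>n. real (Suc n) + \<epsilon>) at_top sequentially" by real_asymp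
      from filterlim_compose[OF mass this]
      have "(\<lambda>n. - (real (Suc n) + \<epsilon>) * Im (G (\<i> * of_real (real (Suc n) + \<epsilon>)))) \<longlonglongrightarrow> 1" .
      moreover have "(\<lambda>n. real (Suc n) / (real (Suc n) + \<epsilon>)) \<longlonglongrightarrow> 1" by real_asymp
      ultimately have "(\<lambda>n. real (Suc n) / (real (Suc n) + \<epsilon>)
          * (- (real (Suc n) + \<epsilon>) * Im (G (\<i> * of_real (real (Suc n) + \<epsilon>))))) \<longlonglongrightarrow> 1 * 1"
        by (intro tendsto_mult)
      moreover have "real (Suc n) / (real (Suc n) + \<epsilon>) * (- (real (Suc n) + \<epsilon>) * c) = - real (Suc n) * c" for n c
        using \<open>\<epsilon> > 0\<close> by (simp add: field_simps)
      ultimately show "(\<lambda>n. - real (Suc n) * Im (G (\<i> * of_real (real (Suc n) + \<epsilon>)))) \<longlonglongrightarrow> 1"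
        by (simp only: mult_1)
    qed
    ultimately show "(\<lambda>n. \<integral>\<^sup>+u. ennreal (p u * h n u) \<partial>lborel) \<longlonglongrightarrow> 1" by simp
  qed
  show ?thesis
  proof (rule that)
    have "prob_space (density lborel p)"
      by (rule prob_spaceI) (simp add: emeasure_density total)
    then show "real_distribution (density lborel p)"
      by (simp add: real_distribution_def real_distribution_axioms_def)
    fix z assume z: "Im z > 0"
    have "(\<integral>u. poisson_kernel z u \<partial>density lborel p) = (\<integral>u. p u *\<^sub>R poisson_kernel z u \<partial>lborel)"
      by (rule integral_density) (use z p_nonneg in auto)
    then show "(\<integral>u. poisson_kernel z u \<partial>density lborel p) = - Im (G (z + \<i> * of_real \<epsilon>))"
      using poisson(2)[OF z] by (simp add: G\<epsilon>_def)
  qed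
qed

text \<open>
  Pointwise \<open>2 y\<^sup>2 / (u\<^sup>2 + y\<^sup>2) - 1\<close> is at most the indicator of \<open>{- y<..y}\<close>.  This turns control of a
  Poisson integral at \<open>\<i> y\<close> into tightness.
\<close>
lemma measure_interval_ge:
  assumes "real_distribution \<nu>" "y > 0"
  shows "measure \<nu> {- y<..y} \<ge> 2 * (y * (\<integral>u. poisson_kernel (\<i> * of_real y) u \<partial>\<nu>)) - 1"
proof -
  interpret real_distribution \<nu> by fact
  let ?z = "\<i> * of_real y"
  have z: "Im ?z > 0" using assms by simp
  have int: "integrable \<nu> (poisson_kernel ?z)"
    by (rule integrable_bounded_continuous[OF continuous_poisson_kernel[OF z], of "1 / Im ?z"])
      (use poisson_kernel_le[OF z] poisson_kernel_nonneg[OF z] in \<open>simp add: abs_of_nonneg\<close>)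
  have le: "2 * (y * poisson_kernel ?z u) - 1 \<le> indicator {- y<..y} u" for u
  proof (cases "u \<in> {- y<..y}")
    case True
    have "y * poisson_kernel ?z u \<le> 1"
      using mult_left_mono[OF poisson_kernel_le[OF z, of u], of y] assms by simp
    then show ?thesis using True by simp
  next
    case False
    then have "y\<^sup>2 \<le> u\<^sup>2" using assms(2) by (auto simp: abs_le_square_iff[symmetric])
    then have "2 * (y * poisson_kernel ?z u) \<le> 1"
      using assms(2) by (simp add: poisson_kernel_def divide_le_eq power2_eq_square add_nonneg_pos)
    then show ?thesis using False by simp
  qed
  have "2 * (y * (\<integral>u. poisson_kernel ?z u \<partial>\<nu>)) - 1 = (\<integral>u. 2 * (y * poisson_kernel ?z u) - 1 \<partial>\<nu>)"
    using int prob_space by simp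
  also have "\<dots> \<le> (\<integral>u. indicator {- y<..y} u \<partial>\<nu>)"
    using int by (intro integral_mono le) (auto simp: emeasure_eq_measure)
  also have "\<dots> = measure \<nu> {- y<..y}" by simp
  finally show ?thesis .
qed

text \<open>
  A nonempty subset of the real line is not open in the plane, so this is the open mapping theorem.
\<close>
lemma holomorphic_Im_zero_imp_constant:
  assumes "f holomorphic_on upper_half_plane" "\<And>z. Im z > 0 \<Longrightarrow> Im (f z) = 0"
  shows "f constant_on upper_half_plane"
proof (rule ccontr)
  have S: "open upper_half_plane" "connected upper_half_plane"
    unfolding upper_half_plane_def
    by (auto simp: open_halfspace_Im_gt convex_halfspace_Im_gt intro!: convex_connected)
  assume "\<not> f constant_on upper_half_plane"
  then have "open (f ` upper_half_plane)"
    using open_mapping_thm[OF assms(1) S S(1)] by auto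
  moreover have "f \<i> \<in> f ` upper_half_plane" by auto
  ultimately obtain e where e: "e > 0" "ball (f \<i>) e \<subseteq> f ` upper_half_plane"
    by (meson openE)
  have "f \<i> + \<i> * of_real (e / 2) \<in> ball (f \<i>) e"
    using e(1) by (simp add: dist_norm norm_mult)
  then obtain z where "Im z > 0" "f z = f \<i> + \<i> * of_real (e / 2)" using e(2) by force
  then show False using assms(2)[of z] assms(2)[of \<i>] e(1) by simp
qed

text \<open>
  Let \<open>\<epsilon> \<rightarrow> 0\<close> in the measures on the lines of height \<open>\<epsilon>\<close>.  They are tight because the mass
  condition on \<open>G\<close> at \<open>\<i> y\<close> for large \<open>y\<close> controls them uniformly in \<open>\<epsilon> \<le> 1\<close>.  A weak limit has the
  Poisson integrals \<open>- Im G\<close>, so its Cauchy transform differs from \<open>G\<close> by a constant, which is zero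
  because both functions tend to zero along the imaginary axis.
\<close>
theorem cauchy_transform_representation:
  fixes G :: "complex \<Rightarrow> complex"
  assumes holo: "G holomorphic_on upper_half_plane"
    and Im_G: "\<And>z. Im z > 0 \<Longrightarrow> Im (G z) \<le> 0"
    and bound: "\<And>z. Im z > 0 \<Longrightarrow> norm (G z) \<le> 1 / Im z"
    and mass: "((\<lambda>y. - y * Im (G (\<i> * of_real y))) \<longlongrightarrow> 1) at_top"
  obtains \<nu> where "real_distribution \<nu>" "\<And>z. Im z > 0 \<Longrightarrow> cauchy_transform \<nu> z = G z"
proof -
  define \<epsilon> where "\<epsilon> n = 1 / real (Suc n)" for n
  have \<epsilon>: "\<epsilon> n > 0" "\<epsilon> n \<le> 1" for n by (simp_all add: \<epsilon>_def)
  have "\<exists>\<nu>. real_distribution \<nu> \<and>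
      (\<forall>z. Im z > 0 \<longrightarrow> (\<integral>u. poisson_kernel z u \<partial>\<nu>) = - Im (G (z + \<i> * of_real (\<epsilon> n))))" for n
    using poisson_density_distribution[OF assms \<epsilon>(1)[of n]] by metis
  then obtain \<nu> where \<nu>: "\<And>n. real_distribution (\<nu> n)"
    and \<nu>_eq: "\<And>n z. Im z > 0 \<Longrightarrow> (\<integral>u. poisson_kernel z u \<partial>\<nu> n) = - Im (G (z + \<i> * of_real (\<epsilon> n)))"
    by metis
  have "tight \<nu>"
    unfolding tight_def
  proof (intro conjI allI impI \<nu>)
    fix \<eta> :: real assume "\<eta> > 0"
    \<comment> \<open>\<open>measure_interval_ge\<close> doubles the loss, so \<open>\<eta> / 2\<close> is available: \<open>\<eta> / 4\<close> goes to the
      limit at infinity and \<open>\<eta> / 4\<close> to the shift from \<open>y\<close> to \<open>y + \<epsilon> n\<close>\<close>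
    have "eventually (\<lambda>y. - y * Im (G (\<i> * of_real y)) > 1 - \<eta> / 4) at_top"
      using order_tendstoD(1)[OF mass, of "1 - \<eta> / 4"] \<open>\<eta> > 0\<close> by simp
    then obtain Y where Y: "\<And>y. y \<ge> Y \<Longrightarrow> - y * Im (G (\<i> * of_real y)) > 1 - \<eta> / 4"
      by (auto simp: eventually_at_top_linorder)
    define y where "y = max Y (4 / \<eta>)"
    have "4 / \<eta> > 0" "4 / \<eta> \<le> y" "y \<ge> Y" using \<open>\<eta> > 0\<close> by (auto simp: y_def)
    moreover from this have "1 / y \<le> 1 / (4 / \<eta>)" by (intro frac_le) auto
    ultimately have y: "y > 0" "y \<ge> Y" "1 / y \<le> \<eta> / 4" by (linarith, linarith, simp)
    have "measure (\<nu> n) {- y<..y} > 1 - \<eta>" for n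
    proof -
      let ?m = "- (y + \<epsilon> n) * Im (G (\<i> * of_real (y + \<epsilon> n)))"
      have m: "?m > 1 - \<eta> / 4" "?m \<le> 1"
        using Y[of "y + \<epsilon> n"] y(1,2) \<epsilon>[of n] imaginary_axis_mass_le[OF bound, of "y + \<epsilon> n"] by auto
      have "y * (\<integral>u. poisson_kernel (\<i> * of_real y) u \<partial>\<nu> n) = ?m - \<epsilon> n / (y + \<epsilon> n) * ?m"
        using y(1) \<epsilon>(1)[of n] by (subst \<nu>_eq) (simp_all add: distrib_left field_simps)
      moreover have "\<epsilon> n / (y + \<epsilon> n) * ?m \<le> 1 / y"
      proof -
        have "\<epsilon> n / (y + \<epsilon> n) * ?m \<le> \<epsilon> n / (y + \<epsilon> n) * 1"
          using m(2) y(1) \<epsilon>(1)[of n] by (intro mult_left_mono) auto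
        also have "\<dots> \<le> 1 / y"
          unfolding mult_1_right using y(1) \<epsilon>[of n] by (intro frac_le) auto
        finally show ?thesis .
      qed
      ultimately show ?thesis
        using measure_interval_ge[OF \<nu>[of n] y(1)] m(1) y(3) by linarith
    qed
    then show "\<exists>a b. a < b \<and> (\<forall>n. 1 - \<eta> < measure (\<nu> n) {a<..b})"
      using y(1) by (intro exI[of _ "- y"] exI[of _ y]) auto
  qed
  then obtain r M where r: "strict_mono (r :: nat \<Rightarrow> nat)" and M: "real_distribution M"
    and conv: "weak_conv_m (\<nu> \<circ> r) M"
    using tight_imp_convergent_subsubsequence[of \<nu> id] by (auto simp: strict_mono_def)
  interpret M: real_distribution M by fact
  have Im_eq: "Im (cauchy_transform M z) = Im (G z)" if z: "Im z > 0" for z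
  proof -
    have "(\<lambda>n. \<integral>u. poisson_kernel z u \<partial>(\<nu> \<circ> r) n) \<longlonglongrightarrow> (\<integral>u. poisson_kernel z u \<partial>M)"
    proof (rule weak_conv_imp_integral_bdd_continuous_conv[OF _ M conv])
      show "real_distribution ((\<nu> \<circ> r) n)" for n using \<nu> by simp
      show "isCont (poisson_kernel z) x" for x
        using continuous_poisson_kernel[OF z] by (simp add: continuous_on_eq_continuous_at)
      show "norm (poisson_kernel z x) \<le> 1 / Im z" for x
        using poisson_kernel_le[OF z, of x] poisson_kernel_nonneg[OF z, of x] by simp
    qed
    moreover have "(\<lambda>n. \<integral>u. poisson_kernel z u \<partial>(\<nu> \<circ> r) n) \<longlonglongrightarrow> - Im (G z)"
    proof -
      have "\<epsilon> \<longlonglongrightarrow> 0" unfolding \<epsilon>_def by real_asymp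
      then have "(\<lambda>n. z + \<i> * of_real (\<epsilon> (r n))) \<longlonglongrightarrow> z + \<i> * of_real 0"
        by (intro tendsto_intros LIMSEQ_subseq_LIMSEQ[OF _ r, unfolded o_def])
      moreover have "isCont G z"
        using holo z holomorphic_on_imp_continuous_on
        by (metis continuous_on_interior interior_eq mem_upper_half_plane open_halfspace_Im_gt upper_half_plane_def)
      ultimately have "(\<lambda>n. G (z + \<i> * of_real (\<epsilon> (r n)))) \<longlonglongrightarrow> G z"
        using isCont_tendsto_compose by fastforce
      then show ?thesis using z by (simp add: \<nu>_eq tendsto_minus tendsto_Im)
    qed
    ultimately show ?thesis
      using LIMSEQ_unique M.Im_cauchy_transform_poisson[OF z] by fastforce
  qed
  define D where "D z = G z - cauchy_transform M z" for z
  have "D holomorphic_on upper_half_plane"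
    unfolding D_def by (intro holomorphic_intros holo M.holomorphic_cauchy_transform)
  then have "D constant_on upper_half_plane"
    by (rule holomorphic_Im_zero_imp_constant) (simp add: D_def Im_eq)
  then obtain c where c: "\<And>z. Im z > 0 \<Longrightarrow> D z = c"
    by (auto simp: constant_on_def)
  have "norm c \<le> 2 / y" if "y > 0" for y
  proof -
    let ?z = "\<i> * of_real y"
    have z: "Im ?z > 0" using that by simp
    have "norm c \<le> norm (G ?z) + norm (cauchy_transform M ?z)"
      unfolding c[OF z, symmetric] D_def by (rule norm_triangle_ineq4)
    also have "\<dots> \<le> 1 / Im ?z + 1 / Im ?z"
      using bound[OF z] M.norm_cauchy_transform_le[OF z] M.prob_space by (simp add: M.borel_UNIV)
    finally show ?thesis by simp
  qed
  then have "norm c \<le> 0"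
    by (intro tendsto_lowerbound[of "\<lambda>y. 2 / y" 0 at_top "norm c"])
      (real_asymp, auto intro: eventually_mono[OF eventually_gt_at_top[of 0]])
  then have "cauchy_transform M z = G z" if "Im z > 0" for z
    using c[OF that] by (simp add: D_def)
  with M that show ?thesis by blast
qed

section \<open>Stieltjes inversion\<close>

lemma poisson_kernel_symmetric:
  "poisson_kernel (Complex u y) x = poisson_kernel (Complex x y) u"
  by (simp add: poisson_kernel_def power2_commute)

lemma poisson_integral_eq_integral_at_imaginary_unit:
  assumes "y > 0"
  shows "(\<integral>u. poisson_kernel (Complex x y) u * \<phi> u \<partial>lborel)
       = (\<integral>v. poisson_kernel \<i> v * \<phi> (x + y * v) \<partial>lborel)"
proof -
  have kern: "y * poisson_kernel (Complex x y) (x + y * v) = poisson_kernel \<i> v" for v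
  proof -
    have "(y * v)\<^sup>2 + y\<^sup>2 = y * y * (v\<^sup>2 + 1)" by (simp add: power2_eq_square algebra_simps)
    moreover have "v\<^sup>2 + 1 > 0" by (simp add: add_nonneg_pos)
    ultimately show ?thesis using assms by (simp add: poisson_kernel_def)
  qed
  have "(\<integral>u. poisson_kernel (Complex x y) u * \<phi> u \<partial>lborel)
      = y * (\<integral>v. poisson_kernel (Complex x y) (x + y * v) * \<phi> (x + y * v) \<partial>lborel)"
    using lborel_integral_real_affine[of y "\<lambda>u. poisson_kernel (Complex x y) u * \<phi> u" x] assms by simp
  also have "\<dots> = (\<integral>v. y * poisson_kernel (Complex x y) (x + y * v) * \<phi> (x + y * v) \<partial>lborel)"
    by (simp add: mult.assoc)
  finally show ?thesis by (simp add: kern)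
qed

lemma
  fixes \<phi> :: "real \<Rightarrow> real"
  assumes "Im z > 0" "\<phi> \<in> borel_measurable borel" "\<And>x. \<bar>\<phi> x\<bar> \<le> B"
  shows integrable_poisson_kernel_mult: "integrable lborel (\<lambda>u. poisson_kernel z u * \<phi> u)"
    and poisson_integral_le: "\<bar>\<integral>u. poisson_kernel z u * \<phi> u \<partial>lborel\<bar> \<le> B * pi"
proof -
  have le: "norm (poisson_kernel z u * \<phi> u) \<le> B * poisson_kernel z u" for u
    using poisson_kernel_nonneg[OF assms(1), of u] assms(3)[of u]
    by (simp add: abs_mult mult_right_mono mult.commute)
  have B: "integrable lborel (\<lambda>u. B * poisson_kernel z u)"
    using integrable_poisson_kernel[OF assms(1)] by simp
  show int: "integrable lborel (\<lambda>u. poisson_kernel z u * \<phi> u)"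
  proof (rule Bochner_Integration.integrable_bound[OF B])
    show "(\<lambda>u. poisson_kernel z u * \<phi> u) \<in> borel_measurable lborel"
      using assms(2) poisson_kernel_measurable[OF assms(1)] by simp
    show "AE u in lborel. norm (poisson_kernel z u * \<phi> u) \<le> norm (B * poisson_kernel z u)"
      by (intro AE_I2 order_trans[OF le]) simp
  qed
  have "\<bar>\<integral>u. poisson_kernel z u * \<phi> u \<partial>lborel\<bar> \<le> (\<integral>u. norm (poisson_kernel z u * \<phi> u) \<partial>lborel)"
    using integral_norm_bound[of lborel "\<lambda>u. poisson_kernel z u * \<phi> u"] by simp
  also have "\<dots> \<le> (\<integral>u. B * poisson_kernel z u \<partial>lborel)"
    by (intro integral_mono integrable_norm int B le)
  finally show "\<bar>\<integral>u. poisson_kernel z u * \<phi> u \<partial>lborel\<bar> \<le> B * pi"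
    by (simp add: integral_poisson_kernel[OF assms(1)])
qed

lemma poisson_integral_tendsto:
  fixes \<phi> :: "real \<Rightarrow> real"
  assumes \<phi>: "continuous_on UNIV \<phi>" "\<And>x. \<bar>\<phi> x\<bar> \<le> B"
    and y: "\<And>n. y n > 0" "y \<longlonglongrightarrow> 0"
  shows "(\<lambda>n. \<integral>u. poisson_kernel (Complex x (y n)) u * \<phi> u \<partial>lborel) \<longlonglongrightarrow> pi * \<phi> x"
proof -
  have [measurable]: "\<phi> \<in> borel_measurable borel" using \<phi>(1) by (rule borel_measurable_continuous_onI)
  have "(\<lambda>n. \<integral>v. poisson_kernel \<i> v * \<phi> (x + y n * v) \<partial>lborel) \<longlonglongrightarrow> (\<integral>v. poisson_kernel \<i> v * \<phi> x \<partial>lborel)"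
  proof (rule integral_dominated_convergence[where w = "\<lambda>v. B * poisson_kernel \<i> v"])
    show "integrable lborel (\<lambda>v. B * poisson_kernel \<i> v)" using integrable_poisson_kernel[of \<i>] by simp
    have "norm (poisson_kernel \<i> v * \<phi> (x + y n * v)) \<le> B * poisson_kernel \<i> v" for n v
      using mult_right_mono[OF \<phi>(2)[of "x + y n * v"] poisson_kernel_nonneg[of \<i> v]] poisson_kernel_nonneg[of \<i> v]
      by (simp add: abs_mult mult.commute)
    then show "AE v in lborel. norm (poisson_kernel \<i> v * \<phi> (x + y n * v)) \<le> B * poisson_kernel \<i> v" for n
      by (intro AE_I2)
    show "AE v in lborel. (\<lambda>n. poisson_kernel \<i> v * \<phi> (x + y n * v)) \<longlonglongrightarrow> poisson_kernel \<i> v * \<phi> x"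
    proof (intro AE_I2 tendsto_mult tendsto_const)
      fix v
      have "(\<lambda>n. x + y n * v) \<longlonglongrightarrow> x + 0 * v" by (intro tendsto_intros y)
      moreover have "isCont \<phi> x" using \<phi>(1) by (simp add: continuous_on_eq_continuous_at)
      ultimately show "(\<lambda>n. \<phi> (x + y n * v)) \<longlonglongrightarrow> \<phi> x"
        using isCont_tendsto_compose by fastforce
    qed
  qed (use poisson_kernel_measurable[of \<i>] in simp_all)
  then show ?thesis
    using integral_poisson_kernel[of \<i>]
    by (simp add: poisson_integral_eq_integral_at_imaginary_unit[OF y(1)])
qed

text \<open>
  By Fubini and the symmetry of the Poisson kernel, smearing the measure at height \<open>y n\<close> is the same as
  smearing the test function, and the Poisson integrals of a bounded continuous function converge to it
  boundedly.
\<close>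
theorem Stieltjes_inversion:
  fixes \<phi> :: "real \<Rightarrow> real"
  assumes "real_distribution \<kappa>"
    and \<phi>: "continuous_on UNIV \<phi>" "\<And>x. \<bar>\<phi> x\<bar> \<le> B"
    and y: "\<And>n. y n > 0" "y \<longlonglongrightarrow> 0"
  shows "(\<lambda>n. - (1 / pi) * (\<integral>u. \<phi> u * Im (cauchy_transform \<kappa> (Complex u (y n))) \<partial>lborel))
     \<longlonglongrightarrow> (\<integral>x. \<phi> x \<partial>\<kappa>)"
proof -
  interpret real_distribution \<kappa> by fact
  interpret pair_sigma_finite \<kappa> lborel
    by (simp add: pair_sigma_finite_def sigma_finite_measure_axioms sigma_finite_lborel)
  have \<phi>_meas [measurable]: "\<phi> \<in> borel_measurable borel" using \<phi>(1) by (rule borel_measurable_continuous_onI)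
  have "B \<ge> 0" using \<phi>(2)[of 0] by linarith
  define P where "P n x = (\<integral>u. poisson_kernel (Complex x (y n)) u * \<phi> u \<partial>lborel)" for n x
  have joint: "(\<lambda>(x, u). poisson_kernel (Complex x (y n)) u * \<psi> u) \<in> borel_measurable (\<kappa> \<Otimes>\<^sub>M lborel)"
    if [measurable]: "\<psi> \<in> borel_measurable borel" for n and \<psi> :: "real \<Rightarrow> real"
    unfolding poisson_kernel_def complex.sel by measurable
  have P_meas: "P n \<in> borel_measurable \<kappa>" for n
    unfolding P_def by (rule lborel.borel_measurable_lebesgue_integral) (use joint[OF \<phi>_meas] in simp)
  have Fubini: "- (\<integral>u. \<phi> u * Im (cauchy_transform \<kappa> (Complex u (y n))) \<partial>lborel) = (\<integral>x. P n x \<partial>\<kappa>)" for n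
  proof -
    have "- (\<phi> u * Im (cauchy_transform \<kappa> (Complex u (y n))))
        = (\<integral>x. poisson_kernel (Complex x (y n)) u * \<phi> u \<partial>\<kappa>)" for u
      using Im_cauchy_transform_poisson[of "Complex u (y n)"] y(1)
      by (simp add: poisson_kernel_symmetric[of u] mult.commute)
    then have "- (\<integral>u. \<phi> u * Im (cauchy_transform \<kappa> (Complex u (y n))) \<partial>lborel)
        = (\<integral>u. (\<integral>x. poisson_kernel (Complex x (y n)) u * \<phi> u \<partial>\<kappa>) \<partial>lborel)"
      by (simp flip: integral_minus)
    also have "\<dots> = (\<integral>x. P n x \<partial>\<kappa>)"
      unfolding P_def
    proof (rule Fubini_integral, rule Fubini_integrable)
      show "(\<lambda>(x, u). poisson_kernel (Complex x (y n)) u * \<phi> u) \<in> borel_measurable (\<kappa> \<Otimes>\<^sub>M lborel)"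
        by (rule joint) simp
      show "AE x in \<kappa>. integrable lborel (\<lambda>u. case (x, u) of (x, u) \<Rightarrow> poisson_kernel (Complex x (y n)) u * \<phi> u)"
        using integrable_poisson_kernel_mult[OF _ \<phi>_meas \<phi>(2)] y(1) by simp
      have eq: "norm (poisson_kernel (Complex x (y n)) u * \<phi> u) = poisson_kernel (Complex x (y n)) u * \<bar>\<phi> u\<bar>" for x u
        using poisson_kernel_nonneg[of "Complex x (y n)"] y(1) by (simp add: abs_mult)
      show "integrable \<kappa> (\<lambda>x. \<integral>u. norm (case (x, u) of (x, u) \<Rightarrow> poisson_kernel (Complex x (y n)) u * \<phi> u) \<partial>lborel)"
        unfolding prod.case eq
      proof (rule integrable_const_bound[where B = "B * pi"])
        show "(\<lambda>x. \<integral>u. poisson_kernel (Complex x (y n)) u * \<bar>\<phi> u\<bar> \<partial>lborel) \<in> borel_measurable \<kappa>"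
          by (rule lborel.borel_measurable_lebesgue_integral) (use joint[of "\<lambda>u. \<bar>\<phi> u\<bar>"] in simp)
        show "AE x in \<kappa>. norm (\<integral>u. poisson_kernel (Complex x (y n)) u * \<bar>\<phi> u\<bar> \<partial>lborel) \<le> B * pi"
          using poisson_integral_le[of "Complex _ (y n)" "\<lambda>u. \<bar>\<phi> u\<bar>" B] y(1) \<phi>(2) by simp
      qed
    qed
    finally show ?thesis .
  qed
  have "(\<lambda>n. \<integral>x. P n x \<partial>\<kappa>) \<longlonglongrightarrow> (\<integral>x. pi * \<phi> x \<partial>\<kappa>)"
  proof (rule integral_dominated_convergence[where w = "\<lambda>_. B * pi"])
    show "AE x in \<kappa>. (\<lambda>n. P n x) \<longlonglongrightarrow> pi * \<phi> x"
      unfolding P_def by (intro AE_I2 poisson_integral_tendsto[OF \<phi> y])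
    show "AE x in \<kappa>. norm (P n x) \<le> B * pi" for n
      unfolding P_def using poisson_integral_le[OF _ \<phi>_meas \<phi>(2)] y(1) by simp
  qed (use P_meas in auto)
  then have "(\<lambda>n. 1 / pi * (\<integral>x. P n x \<partial>\<kappa>)) \<longlonglongrightarrow> 1 / pi * (\<integral>x. pi * \<phi> x \<partial>\<kappa>)"
    by (intro tendsto_mult tendsto_const)
  then show ?thesis by (simp add: Fubini[symmetric])
qed

lemma cdf_eq_lim_cts_step:
  assumes "real_distribution \<kappa>"
  shows "(\<lambda>n. \<integral>x. cts_step a (a + 1 / real (Suc n)) x \<partial>\<kappa>) \<longlonglongrightarrow> cdf \<kappa> a"
proof -
  interpret real_distribution \<kappa> by fact
  have "(\<lambda>n. a + 1 / real (Suc n)) \<longlonglongrightarrow> a" by real_asymp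
  then have "filterlim (\<lambda>n. a + 1 / real (Suc n)) (at_right a) sequentially"
    by (auto simp: filterlim_at)
  then have lim: "(\<lambda>n. cdf \<kappa> (a + 1 / real (Suc n))) \<longlonglongrightarrow> cdf \<kappa> a"
    using cdf_is_right_cont[of a] filterlim_compose unfolding continuous_within by blast
  show ?thesis
    by (rule tendsto_sandwich[OF _ _ tendsto_const lim]) (auto intro!: always_eventually cdf_cts_step)
qed

lemma continuous_cts_step: "a < b \<Longrightarrow> continuous_on UNIV (cts_step a b)"
  by (intro uniformly_continuous_imp_continuous cts_step_uniformly_continuous)

lemma cts_step_bound: "a < b \<Longrightarrow> \<bar>cts_step a b x\<bar> \<le> 1"
  by (simp add: cts_step_def)

text \<open>
  The approximant of the distribution function at \<open>a\<close> that Stieltjes inversion provides, for a ramp of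
  width \<open>1 / (m + 1)\<close> at height \<open>1 / (n + 1)\<close>.  It depends on the measure only through its Cauchy
  transform \<open>G\<close>.
\<close>
definition smoothed_cdf :: "(complex \<Rightarrow> complex) \<Rightarrow> real \<Rightarrow> nat \<Rightarrow> nat \<Rightarrow> real" where
  "smoothed_cdf G a m n = - (1 / pi) *
     (\<integral>u. cts_step a (a + 1 / real (Suc m)) u * Im (G (Complex u (1 / real (Suc n)))) \<partial>lborel)"

lemma cdf_from_cauchy_transform:
  assumes "real_distribution \<kappa>" "\<And>z. Im z > 0 \<Longrightarrow> cauchy_transform \<kappa> z = G z"
  shows "(\<lambda>m. lim (smoothed_cdf G a m)) \<longlonglongrightarrow> cdf \<kappa> a"
    and "convergent (smoothed_cdf G a m)"
proof -
  have lim: "smoothed_cdf G a m \<longlonglongrightarrow> (\<integral>x. cts_step a (a + 1 / real (Suc m)) x \<partial>\<kappa>)" for m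
  proof -
    have "(\<lambda>n. 1 / real (Suc n)) \<longlonglongrightarrow> 0" by real_asymp
    from Stieltjes_inversion[OF assms(1) continuous_cts_step cts_step_bound _ this, of a "a + 1 / real (Suc m)"]
    show ?thesis using assms(2) by (simp add: smoothed_cdf_def[abs_def])
  qed
  then show "convergent (smoothed_cdf G a m)" by (auto simp: convergent_def)
  show "(\<lambda>m. lim (smoothed_cdf G a m)) \<longlonglongrightarrow> cdf \<kappa> a"
    using cdf_eq_lim_cts_step[OF assms(1), of a] by (simp add: limI[OF lim])
qed

theorem cauchy_transform_unique:
  assumes "real_distribution \<kappa>" "real_distribution \<kappa>'"
    and "\<And>z. Im z > 0 \<Longrightarrow> cauchy_transform \<kappa> z = cauchy_transform \<kappa>' z"
  shows "\<kappa> = \<kappa>'"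
proof (rule cdf_unique[OF assms(1,2)], rule ext)
  fix a
  show "cdf \<kappa> a = cdf \<kappa>' a"
    using LIMSEQ_unique[OF cdf_from_cauchy_transform(1)[OF assms(1,3)] cdf_from_cauchy_transform(1)[OF assms(2) refl]] .
qed

text \<open>
  The distribution function of \<open>k x\<close> is a double limit of the approximants above, and these
  are integrals of functions that are jointly measurable in \<open>x\<close> and the integration variable.
\<close>
theorem measurable_kernel_from_cauchy_transform:
  assumes k: "\<And>x. real_distribution (k x)"
    and C: "\<And>x z. Im z > 0 \<Longrightarrow> cauchy_transform (k x) z = 1 / (h z - complex_of_real x)"
    and h: "continuous_on upper_half_plane h"
  shows "k \<in> borel \<rightarrow>\<^sub>M prob_algebra borel"
proof (rule measurable_prob_algebra_generated[where \<Omega> = UNIV and G = "range atMost"])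
  show "sets borel = sigma_sets UNIV (range (atMost :: real \<Rightarrow> real set))"
    by (simp add: borel_eq_atMost)
  show "Int_stable (range (atMost :: real \<Rightarrow> real set))"
    by (auto simp: Int_stable_def)
  show "prob_space (k x)" for x using k by (simp add: real_distribution_def)
  show "sets (k x) = sets borel" for x
    using k by (simp add: real_distribution_def real_distribution_axioms_def)
  fix A assume "A \<in> range (atMost :: real \<Rightarrow> real set)"
  then obtain a where A: "A = {..a}" by blast
  have "(\<lambda>x. smoothed_cdf (\<lambda>z. 1 / (h z - complex_of_real x)) a m n) \<in> borel_measurable borel" for m n
  proof -
    have [measurable]: "(\<lambda>u. h (Complex u (1 / real (Suc n)))) \<in> borel_measurable borel"
      by (intro borel_measurable_continuous_onI continuous_on_compose2[OF h])
        (auto simp: Complex_eq intro!: continuous_intros)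
    have [measurable]: "cts_step a (a + 1 / real (Suc m)) \<in> borel_measurable borel"
      by (intro borel_measurable_continuous_onI continuous_cts_step) simp
    have "(\<lambda>x. \<integral>u. cts_step a (a + 1 / real (Suc m)) u * Im (1 / (h (Complex u (1 / real (Suc n))) - complex_of_real x)) \<partial>lborel)
        \<in> borel_measurable borel"
      by (rule lborel.borel_measurable_lebesgue_integral) measurable
    then show ?thesis unfolding smoothed_cdf_def by measurable
  qed
  then have "(\<lambda>x. lim (smoothed_cdf (\<lambda>z. 1 / (h z - complex_of_real x)) a m)) \<in> borel_measurable borel" for m
    by (rule borel_measurable_LIMSEQ_real[rotated])
      (use cdf_from_cauchy_transform(2)[OF k C] in \<open>simp add: convergent_LIMSEQ_iff\<close>)
  then have "(\<lambda>x. cdf (k x) a) \<in> borel_measurable borel"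
    by (rule borel_measurable_LIMSEQ_real[rotated]) (rule cdf_from_cauchy_transform(1)[OF k C])
  moreover have "emeasure (k x) A = ennreal (cdf (k x) a)" for x
  proof -
    interpret real_distribution "k x" by (rule k)
    show ?thesis by (simp add: A cdf_def emeasure_eq_measure)
  qed
  ultimately show "(\<lambda>x. emeasure (k x) A) \<in> borel_measurable borel" by simp
qed auto

section \<open>Composition of kernels\<close>

lemma cauchy_transform_return: "Im z > 0 \<Longrightarrow> cauchy_transform (return borel x) z = 1 / (z - complex_of_real x)"
  unfolding cauchy_transform_def
  by (subst integral_return) (auto intro!: borel_measurable_continuous_onI continuous_Cauchy_kernel)

lemma real_distribution_return: "real_distribution (return borel x)"
  by (simp add: real_distribution_def real_distribution_axioms_def prob_space_return)

lemma
  assumes M: "real_distribution M" and k: "k \<in> borel \<rightarrow>\<^sub>M prob_algebra borel"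
  shows real_distribution_bind: "real_distribution (M \<bind> k)"
    and cauchy_transform_bind:
      "Im z > 0 \<Longrightarrow> cauchy_transform (M \<bind> k) z = (\<integral>u. cauchy_transform (k u) z \<partial>M)"
proof -
  interpret M: real_distribution M by (rule M)
  have k_sub: "k \<in> M \<rightarrow>\<^sub>M subprob_algebra borel"
    using measurable_prob_algebraD[OF k] by (simp add: measurable_cong_sets[OF M.M_is_borel refl])
  have k_prob: "prob_space (k u)" "sets (k u) = sets borel" for u
    using measurable_space[OF k, of u] by (auto simp: space_prob_algebra)
  have dist: "real_distribution (k u)" for u
    using k_prob by (simp add: real_distribution_def real_distribution_axioms_def)
  have "prob_space (M \<bind> k)"
    by (rule M.prob_space_bind[OF _ k_sub]) (simp add: k_prob)
  then show bind: "real_distribution (M \<bind> k)"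
    using sets_bind[of M k borel] k_prob(2) M.not_empty by (simp add: real_distribution_def real_distribution_axioms_def)
  assume z: "Im z > 0"
  let ?c = "\<lambda>v. 1 / (z - complex_of_real v)"
  have meas: "(\<lambda>v. Re (?c v)) \<in> borel_measurable borel" "(\<lambda>v. Im (?c v)) \<in> borel_measurable borel"
    by (intro borel_measurable_continuous_onI continuous_intros continuous_Cauchy_kernel z)+
  have le: "\<bar>Re (?c v)\<bar> \<le> 1 / Im z" "\<bar>Im (?c v)\<bar> \<le> 1 / Im z" for v
    using norm_Cauchy_kernel_le[OF z, of v] abs_Re_le_cmod[of "?c v"] abs_Im_le_cmod[of "?c v"] by linarith+
  have mass: "AE u in M. emeasure (k u) (space (k u)) \<le> ennreal 1"
    using k_prob(1) by (simp add: prob_space.emeasure_space_1)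
  have int_bind: "integrable (M \<bind> k) ?c"
    using real_distribution.finite_borel_measure_M[OF bind] z
    by (rule finite_borel_measure.integrable_Cauchy_kernel)
  have int_k: "integrable (k u) ?c" for u
    using real_distribution.finite_borel_measure_M[OF dist] z
    by (rule finite_borel_measure.integrable_Cauchy_kernel)
  have C_meas: "(\<lambda>u. \<integral>v. ?c v \<partial>k u) \<in> borel_measurable M"
    by (rule measurable_compose[OF k_sub integral_measurable_subprob_algebra])
      (intro borel_measurable_continuous_onI continuous_Cauchy_kernel z)
  have int_C: "integrable M (\<lambda>u. \<integral>v. ?c v \<partial>k u)"
  proof (rule M.integrable_const_bound[where B = "1 / Im z", OF _ C_meas])
    have "norm (\<integral>v. ?c v \<partial>k u) \<le> 1 / Im z" for u
      using finite_borel_measure.norm_cauchy_transform_le[OF real_distribution.finite_borel_measure_M[OF dist] z, of u]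
        prob_space.prob_space[OF k_prob(1), of u] real_distribution.space_eq_univ[OF dist, of u]
      by (simp add: cauchy_transform_def)
    then show "AE u in M. norm (\<integral>v. ?c v \<partial>k u) \<le> 1 / Im z" by simp
  qed
  have "Re (\<integral>v. ?c v \<partial>(M \<bind> k)) = Re (\<integral>u. (\<integral>v. ?c v \<partial>k u) \<partial>M)"
    unfolding integral_Re[OF int_bind, symmetric] integral_Re[OF int_C, symmetric] integral_Re[OF int_k, symmetric]
    by (rule integral_bind[OF meas(1) le(1) k_sub M.finite_measure_axioms mass])
  moreover have "Im (\<integral>v. ?c v \<partial>(M \<bind> k)) = Im (\<integral>u. (\<integral>v. ?c v \<partial>k u) \<partial>M)"
    unfolding integral_Im[OF int_bind, symmetric] integral_Im[OF int_C, symmetric] integral_Im[OF int_k, symmetric]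
    by (rule integral_bind[OF meas(2) le(2) k_sub M.finite_measure_axioms mass])
  ultimately show "cauchy_transform (M \<bind> k) z = (\<integral>u. cauchy_transform (k u) z \<partial>M)"
    unfolding cauchy_transform_def by (simp add: complex_eq_iff)
qed

section \<open>The transition kernel of a driving path\<close>

text \<open>
  The bound on \<open>h z - z\<close> is what gives the measure total mass one: it forces \<open>h(\<i> y) / (\<i> y) \<rightarrow> 1\<close>.
\<close>
lemma kernel_measure_exists:
  assumes holo: "h holomorphic_on upper_half_plane"
    and Im_h: "\<And>z. Im z > 0 \<Longrightarrow> Im z \<le> Im (h z)"
    and disp: "\<And>z. Im z > 0 \<Longrightarrow> norm (h z - z) \<le> C / Im z"
  obtains \<kappa> where "real_distribution \<kappa>"
    "\<And>z. Im z > 0 \<Longrightarrow> cauchy_transform \<kappa> z = 1 / (h z - complex_of_real x)"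
proof -
  let ?G = "\<lambda>z. 1 / (h z - complex_of_real x)"
  have pos: "Im (h z) > 0" if "Im z > 0" for z using Im_h[OF that] that by linarith
  show ?thesis
  proof (rule cauchy_transform_representation[of ?G])
    show "?G holomorphic_on upper_half_plane"
      using diff_of_real_nonzero[OF pos] by (intro holomorphic_intros holo) (auto simp del: right_minus_eq)
    fix z assume z: "Im z > 0"
    show "Im (?G z) \<le> 0"
      using pos[OF z] unfolding Im_Cauchy_kernel by (simp add: divide_nonpos_nonneg)
    have "norm (?G z) \<le> 1 / Im (h z)" by (rule norm_Cauchy_kernel_le[OF pos[OF z]])
    also have "\<dots> \<le> 1 / Im z" using Im_h[OF z] z by (intro divide_left_mono) auto
    finally show "norm (?G z) \<le> 1 / Im z" .
  next
    have "((\<lambda>y. (h (\<i> * of_real y) - \<i> * of_real y - of_real x) / (\<i> * of_real y)) \<longlongrightarrow> 0) at_top"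
    proof (rule Lim_null_comparison)
      show "((\<lambda>y. (C / y + \<bar>x\<bar>) / y) \<longlongrightarrow> 0) at_top" by real_asymp
      have "norm ((h (\<i> * of_real y) - \<i> * of_real y - of_real x) / (\<i> * of_real y)) \<le> (C / y + \<bar>x\<bar>) / y"
        if "y > 0" for y
      proof -
        have "norm (h (\<i> * of_real y) - \<i> * of_real y - of_real x) \<le> C / y + \<bar>x\<bar>"
          using norm_triangle_ineq4[of "h (\<i> * of_real y) - \<i> * of_real y" "complex_of_real x"]
            disp[of "\<i> * of_real y"] that by simp
        then show ?thesis using that by (simp add: norm_divide norm_mult divide_right_mono)
      qed
      then show "\<forall>\<^sub>F y in at_top. norm ((h (\<i> * of_real y) - \<i> * of_real y - of_real x) / (\<i> * of_real y))
          \<le> (C / y + \<bar>x\<bar>) / y"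
        by (intro eventually_mono[OF eventually_gt_at_top[of 0]])
    qed
    then have "((\<lambda>y. 1 / (1 + (h (\<i> * of_real y) - \<i> * of_real y - of_real x) / (\<i> * of_real y))) \<longlongrightarrow> 1 / (1 + 0)) at_top"
      by (intro tendsto_intros) auto
    from tendsto_Re[OF this]
    have lim: "((\<lambda>y. Re (1 / (1 + (h (\<i> * of_real y) - \<i> * of_real y - of_real x) / (\<i> * of_real y)))) \<longlongrightarrow> 1) at_top"
      by simp
    show "((\<lambda>y. - y * Im (?G (\<i> * of_real y))) \<longlongrightarrow> 1) at_top"
    proof (rule Lim_transform_eventually[OF lim])
      have "Re (1 / (1 + (h (\<i> * of_real y) - \<i> * of_real y - of_real x) / (\<i> * of_real y))) = - y * Im (?G (\<i> * of_real y))"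
        if y: "y > 0" for y
      proof -
        have "h (\<i> * of_real y) - of_real x \<noteq> 0"
          using pos[of "\<i> * of_real y"] y by (intro diff_of_real_nonzero) auto
        then have "1 / (1 + (h (\<i> * of_real y) - \<i> * of_real y - of_real x) / (\<i> * of_real y)) = (\<i> * of_real y) * ?G (\<i> * of_real y)"
          using y by (simp add: divide_simps)
        moreover have "Re (\<i> * of_real y * g) = - y * Im g" for g by simp
        ultimately show ?thesis by (simp only:)
      qed
      then show "\<forall>\<^sub>F y in at_top. Re (1 / (1 + (h (\<i> * of_real y) - \<i> * of_real y - of_real x) / (\<i> * of_real y)))
          = - y * Im (?G (\<i> * of_real y))"
        by (intro eventually_mono[OF eventually_gt_at_top[of 0]])
    qed
  qed (use that in auto)
qed

context driving_path
begin

text \<open>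
  The measure is determined by its Cauchy transform, so the choice operator only selects it.
\<close>
definition transition_kernel :: "real \<Rightarrow> real \<Rightarrow> real \<Rightarrow> real measure" where
  "transition_kernel s t x = (SOME \<kappa>. real_distribution \<kappa> \<and>
     (\<forall>z. Im z > 0 \<longrightarrow> cauchy_transform \<kappa> z = 1 / (back_flow s t z - complex_of_real x)))"

lemma transition_kernel:
  assumes "0 \<le> s" "s \<le> t"
  shows real_distribution_transition_kernel: "real_distribution (transition_kernel s t x)"
    and cauchy_transform_transition_kernel: "Im z > 0 \<Longrightarrow>
      cauchy_transform (transition_kernel s t x) z = 1 / (back_flow s t z - complex_of_real x)"
proof -
  have "0 \<le> t" using assms by simp
  have "back_flow s t holomorphic_on upper_half_plane"
    using conformal_back_flow[OF assms] by (simp add: conformal_self_map_def)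
  then obtain \<kappa> where "real_distribution \<kappa>"
    "\<And>z. Im z > 0 \<Longrightarrow> cauchy_transform \<kappa> z = 1 / (back_flow s t z - complex_of_real x)"
    using kernel_measure_exists[of "back_flow s t" "mass_bound * t" x]
      Im_back_flow[OF \<open>0 \<le> t\<close> _ assms(2)] back_flow_displacement[OF assms] by blast
  then have "\<exists>\<kappa>. real_distribution \<kappa> \<and>
      (\<forall>z. Im z > 0 \<longrightarrow> cauchy_transform \<kappa> z = 1 / (back_flow s t z - complex_of_real x))" by blast
  from someI_ex[OF this]
  show "real_distribution (transition_kernel s t x)"
    "Im z > 0 \<Longrightarrow> cauchy_transform (transition_kernel s t x) z = 1 / (back_flow s t z - complex_of_real x)"
    unfolding transition_kernel_def by blast+
qed

lemma transition_kernel_unique: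
  assumes "0 \<le> s" "s \<le> t" "real_distribution \<kappa>"
    "\<And>z. Im z > 0 \<Longrightarrow> cauchy_transform \<kappa> z = 1 / (back_flow s t z - complex_of_real x)"
  shows "\<kappa> = transition_kernel s t x"
  by (rule cauchy_transform_unique[OF assms(3) real_distribution_transition_kernel[OF assms(1,2)]])
    (simp add: assms cauchy_transform_transition_kernel)

lemma measurable_transition_kernel:
  assumes "0 \<le> s" "s \<le> t"
  shows "transition_kernel s t \<in> borel \<rightarrow>\<^sub>M prob_algebra borel"
proof (rule measurable_kernel_from_cauchy_transform)
  show "continuous_on upper_half_plane (back_flow s t)"
    using conformal_back_flow[OF assms]
    by (simp add: conformal_self_map_def holomorphic_on_imp_continuous_on)
qed (use assms in \<open>auto intro: real_distribution_transition_kernel cauchy_transform_transition_kernel\<close>)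

lemma Chapman_Kolmogorov:
  assumes "0 \<le> s" "s \<le> r" "r \<le> t"
  shows "transition_kernel s t x = transition_kernel s r x \<bind> transition_kernel r t"
proof -
  have rt: "0 \<le> r" "r \<le> t" using assms by auto
  note dist = real_distribution_transition_kernel[OF assms(1,2)]
  note meas = measurable_transition_kernel[OF rt]
  have "cauchy_transform (transition_kernel s r x \<bind> transition_kernel r t) z
      = 1 / (back_flow s t z - complex_of_real x)" if z: "Im z > 0" for z
  proof -
    have "cauchy_transform (transition_kernel s r x \<bind> transition_kernel r t) z
        = (\<integral>u. 1 / (back_flow r t z - complex_of_real u) \<partial>transition_kernel s r x)"
      by (simp add: cauchy_transform_bind[OF dist meas z] cauchy_transform_transition_kernel[OF rt z])
    also have "\<dots> = 1 / (back_flow s r (back_flow r t z) - complex_of_real x)"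
      using cauchy_transform_transition_kernel[OF assms(1,2), of "back_flow r t z" x] back_flow_pos[of t z r] rt z
      by (simp add: cauchy_transform_def)
    finally show ?thesis using back_flow_back_flow[OF assms z] by simp
  qed
  from transition_kernel_unique[OF _ _ real_distribution_bind[OF dist meas] this] show ?thesis
    using assms by simp
qed

lemma markov_transition_kernel_transition_kernel: "markov_transition_kernel transition_kernel"
  unfolding markov_transition_kernel_def
proof (intro conjI allI impI)
  fix t x :: real assume "0 \<le> t"
  then show "transition_kernel t t x = return borel x"
    by (intro transition_kernel_unique[symmetric])
      (auto simp: real_distribution_return cauchy_transform_return back_flow_end)
qed (use measurable_transition_kernel Chapman_Kolmogorov in auto)

lemma loewner_nu_eq:
  assumes "0 \<le> t"
  shows "loewner_nu \<mu> t = transition_kernel 0 t 0"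
  unfolding loewner_nu_def
proof (rule the_equality)
  show "real_distribution (transition_kernel 0 t 0) \<and>
      (\<forall>z\<in>upper_half_plane. loewner_G \<mu> t z = cauchy_transform (transition_kernel 0 t 0) z)"
    using assms by (simp add: real_distribution_transition_kernel cauchy_transform_transition_kernel loewner_G_eq)
qed (use assms in \<open>auto intro!: transition_kernel_unique simp: loewner_G_eq\<close>)

end

theorem theorem5:
  fixes \<mu> :: "real \<Rightarrow> real measure"
  assumes "\<mu> \<in> Pb"
  shows "(\<forall>s t. 0 \<le> s \<and> s \<le> t \<longrightarrow>
            (\<exists>h. conformal_self_map h \<and>
                 (\<forall>z\<in>upper_half_plane. loewner_G \<mu> s (h z) = loewner_G \<mu> t z)))
       \<and> (\<forall>H. (\<forall>s t. 0 \<le> s \<and> s \<le> t \<longrightarrow>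
                 conformal_self_map (H s t) \<and>
                 (\<forall>z\<in>upper_half_plane. loewner_G \<mu> s (H s t z) = loewner_G \<mu> t z))
           \<longrightarrow> (\<exists>k. markov_transition_kernel k \<and>
                 (\<forall>s t x. 0 \<le> s \<and> s \<le> t \<longrightarrow>
                    (\<forall>z\<in>upper_half_plane.
                       cauchy_transform (k s t x) z = 1 / (H s t z - complex_of_real x)) \<and>
                    (\<forall>\<kappa>. real_distribution \<kappa> \<and>
                       (\<forall>z\<in>upper_half_plane.
                          cauchy_transform \<kappa> z = 1 / (H s t z - complex_of_real x))
                       \<longrightarrow> \<kappa> = k s t x)) \<and>
                 (\<forall>t\<ge>0. loewner_nu \<mu> t = k 0 t 0)))"
proof -
  interpret driving_path \<mu> by unfold_locales (rule assms)
  show ?thesis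
  proof (intro conjI allI impI)
    fix s t :: real assume "0 \<le> s \<and> s \<le> t"
    then show "\<exists>h. conformal_self_map h \<and> (\<forall>z\<in>upper_half_plane. loewner_G \<mu> s (h z) = loewner_G \<mu> t z)"
      by (intro exI[of _ "back_flow s t"]) (auto simp: conformal_back_flow loewner_G_back_flow)
  next
    fix H
    assume H: "\<forall>s t. 0 \<le> s \<and> s \<le> t \<longrightarrow> conformal_self_map (H s t) \<and>
      (\<forall>z\<in>upper_half_plane. loewner_G \<mu> s (H s t z) = loewner_G \<mu> t z)"
    have H_eq: "H s t z = back_flow s t z" if "0 \<le> s" "s \<le> t" "Im z > 0" for s t z
    proof (rule loewner_G_factor_unique[OF that])
      have "conformal_self_map (H s t)" using H that by blast
      then show "Im (H s t z) > 0" using that by (auto simp: conformal_self_map_def image_subset_iff)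
      show "loewner_G \<mu> s (H s t z) = loewner_G \<mu> t z" using H that by simp
    qed
    show "\<exists>k. markov_transition_kernel k \<and>
        (\<forall>s t x. 0 \<le> s \<and> s \<le> t \<longrightarrow>
           (\<forall>z\<in>upper_half_plane. cauchy_transform (k s t x) z = 1 / (H s t z - complex_of_real x)) \<and>
           (\<forall>\<kappa>. real_distribution \<kappa> \<and>
              (\<forall>z\<in>upper_half_plane. cauchy_transform \<kappa> z = 1 / (H s t z - complex_of_real x))
              \<longrightarrow> \<kappa> = k s t x)) \<and>
        (\<forall>t\<ge>0. loewner_nu \<mu> t = k 0 t 0)"
      by (intro exI[of _ transition_kernel] conjI)
        (auto simp: markov_transition_kernel_transition_kernel loewner_nu_eq H_eq
          cauchy_transform_transition_kernel intro!: transition_kernel_unique)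
  qed
qed

end
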